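(* There exists a $5$-uniform hypergraph $\mathcal{H}$ such that the strong game $\mathcal{R}^{(5)}(\mathcal{H}, \aleph_0)$ is a draw.
   Context: For an integer $k\ge 2$ and a finite $k$-uniform hypergraph $\mathcal{H}$, the strong Ramsey game $\mathcal{R}^{(k)}(\mathcal{H}, \aleph_0)$ is played by two players, FP (the first player) and SP (the second player), who alternately claim previously unclaimed edges of the countably infinite complete $k$-uniform hypergraph $K^k_{\mathbb{N}}$ (vertex set $\mathbb{N}$, edges all $k$-subsets), one edge per move, FP moving first. The first player whose claimed edges contain a copy of $\mathcal{H}$ (a subhypergraph isomorphic to $\mathcal{H}$) wins. If neither player has a strategy which ensures his win in finitely many moves, the game is declared a draw. *)

theory Defs
  imports Main
begin

definition board_edges :: "nat \<Rightarrow> nat set set" where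
  "board_edges k = {e. finite e \<and> card e = k}"

definition uniform_hypergraph :: "nat \<Rightarrow> nat set set \<Rightarrow> bool" where
  "uniform_hypergraph k H \<longleftrightarrow> finite H \<and> (\<forall>e\<in>H. finite e \<and> card e = k)"

definition contains_copy :: "nat set set \<Rightarrow> nat set set \<Rightarrow> bool" where
  "contains_copy G H \<longleftrightarrow> (\<exists>f. inj_on f (\<Union>H) \<and> (\<forall>e\<in>H. f ` e \<in> G))"

definition legal_history :: "nat \<Rightarrow> nat set list \<Rightarrow> bool" where
  "legal_history k h \<longleftrightarrow>
     (\<forall>i<length h. h ! i \<in> board_edges k \<and> h ! i \<notin> set (take i h))"

type_synonym strategy = "nat set list \<Rightarrow> nat set"

definition legal_strategy :: "nat \<Rightarrow> strategy \<Rightarrow> bool" where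
  "legal_strategy k \<sigma> \<longleftrightarrow>
     (\<forall>h. legal_history k h \<longrightarrow> \<sigma> h \<in> board_edges k \<and> \<sigma> h \<notin> set h)"

primrec history :: "strategy \<Rightarrow> strategy \<Rightarrow> nat \<Rightarrow> nat set list" where
  "history \<sigma> \<tau> 0 = []"
| "history \<sigma> \<tau> (Suc n) =
     history \<sigma> \<tau> n @ [(if even n then \<sigma> else \<tau>) (history \<sigma> \<tau> n)]"

definition FP_claimed :: "nat set list \<Rightarrow> nat set set" where
  "FP_claimed h = {h ! i | i. i < length h \<and> even i}"

definition SP_claimed :: "nat set list \<Rightarrow> nat set set" where
  "SP_claimed h = {h ! i | i. i < length h \<and> odd i}"

definition someone_has_copy :: "nat set set \<Rightarrow> nat set list \<Rightarrow> bool" where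
  "someone_has_copy H h \<longleftrightarrow> contains_copy (FP_claimed h) H \<or> contains_copy (SP_claimed h) H"

definition FP_wins_at :: "nat set set \<Rightarrow> strategy \<Rightarrow> strategy \<Rightarrow> nat \<Rightarrow> bool" where
  "FP_wins_at H \<sigma> \<tau> n \<longleftrightarrow> even n \<and>
     contains_copy (FP_claimed (history \<sigma> \<tau> (Suc n))) H \<and>
     (\<forall>t<n. \<not> someone_has_copy H (history \<sigma> \<tau> (Suc t)))"

definition SP_wins_at :: "nat set set \<Rightarrow> strategy \<Rightarrow> strategy \<Rightarrow> nat \<Rightarrow> bool" where
  "SP_wins_at H \<sigma> \<tau> n \<longleftrightarrow> odd n \<and>
     contains_copy (SP_claimed (history \<sigma> \<tau> (Suc n))) H \<and>
     (\<forall>t<n. \<not> someone_has_copy H (history \<sigma> \<tau> (Suc t)))"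

definition FP_has_winning_strategy :: "nat \<Rightarrow> nat set set \<Rightarrow> bool" where
  "FP_has_winning_strategy k H \<longleftrightarrow>
     (\<exists>\<sigma>. legal_strategy k \<sigma> \<and>
        (\<forall>\<tau>. legal_strategy k \<tau> \<longrightarrow> (\<exists>n. FP_wins_at H \<sigma> \<tau> n)))"

definition SP_has_winning_strategy :: "nat \<Rightarrow> nat set set \<Rightarrow> bool" where
  "SP_has_winning_strategy k H \<longleftrightarrow>
     (\<exists>\<tau>. legal_strategy k \<tau> \<and>
        (\<forall>\<sigma>. legal_strategy k \<sigma> \<longrightarrow> (\<exists>n. SP_wins_at H \<sigma> \<tau> n)))"

definition strong_game_draw :: "nat \<Rightarrow> nat set set \<Rightarrow> bool" where
  "strong_game_draw k H \<longleftrightarrow>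
     \<not> FP_has_winning_strategy k H \<and> \<not> SP_has_winning_strategy k H"

end

(*
  Let C be the target without two of its edges, insert z R and insert z G, where z lies in no other
  edge. A player owning a copy of C can threaten forever: he claims R plus a fresh vertex, and the
  opponent has to answer with G plus the same vertex. Such answers are useless to the opponent,
  because their fresh vertices have degree at most 2 while every vertex of the target except z has
  degree at least 4. So it suffices that the drawing player completes a copy of C without wasting a
  move, whatever the opponent does, and survives until it is his turn with no threat pending.

  Speed: all edges of C but two can be ordered so that each contains a vertex that is not in the
  previous ones, so the opponent cannot block them in advance. The last two edges s1 and s2 share
  the most recent vertex v, and each of them can be replaced by a symmetric alternative s1' or s2',
  so a pairing strategy obtains them.

  Survival: a threat takes card C + 1 edges, so the first threat of an opponent who has moved once
  more than the drawing player needed for his core uses all of the opponent's edges.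
  Copies of the target sharing all but two edges have the same core (rigidity), hence the blocked
  opponent either keeps making threats of the form above, each met by its unique answer, or has no
  threat left.
*)
theory Submission
  imports Defs "HOL-Combinatorics.Transposition"
begin

section \<open>Drawing strategies from invariants\<close>

text \<open>The delicate point is that a forced answer could itself be a threat and so break the
  chain of forced moves. Such an answer \<open>insert w A\<close> has a fresh vertex
  \<open>w\<close>, so it helps only a core of the opponent that has \<open>A\<close> as one spot;
  it is harmless if the other spot is \<open>B\<close>, because \<open>insert w B\<close> is already
  taken. The drawing player may choose which of his two spots plays the part of \<open>A\<close>,
  and one choice must be safe against all cores of the opponent at once. This conflicts with speed.
  The alternatives for the last two edges come from pairs of twin vertices, so two copies of the
  core that share all but one edge can differ by a swap of twins and need not have the same spots.
  Intersection sizes settle the conflict: the two spots share two vertices, whereas a spot and a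
  spot with one twin swapped share three or one. A draw only requires that the opponent never
  completes a copy, so no infinite play is analysed: an invariant that survives each pair of moves
  is enough, and a supposed winning strategy is refuted at the moment of its win.\<close>

text \<open>Here \<open>F\<close> is the set of edges of the opponent, who is to move, and \<open>S\<close> is that of the
  drawing player. Nothing depends on who started the game, so the same invariant serves both players.\<close>

definition drawing_invariant ::
    "nat \<Rightarrow> nat set set \<Rightarrow> (nat set set \<Rightarrow> nat set set \<Rightarrow> bool) \<Rightarrow> bool" where
  "drawing_invariant k H P \<longleftrightarrow>
     (\<forall>F S x. P F S \<longrightarrow> \<not> contains_copy S H \<longrightarrow> x \<in> board_edges k \<longrightarrow> x \<notin> F \<union> S \<longrightarrow>
        \<not> contains_copy (insert x F) H \<and>
        (\<exists>y\<in>board_edges k. y \<notin> insert x (F \<union> S) \<and> P (insert x F) (insert y S)))"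

lemma not_contains_copy_empty: "H \<noteq> {} \<Longrightarrow> \<not> contains_copy {} H"
  by (auto simp: contains_copy_def)

lemma ex_free_edge:
  assumes "k > 0" "finite X"
  shows "\<exists>y\<in>board_edges k. y \<notin> X"
proof -
  have "infinite (board_edges k)"
  proof
    assume fin: "finite (board_edges k)"
    have "{n..<n+k} \<in> board_edges k" for n by (simp add: board_edges_def)
    then have "range (\<lambda>n. {n..<n+k}) \<subseteq> board_edges k" by blast
    moreover have "inj (\<lambda>n. {n..<n+k})"
      by (rule injI) (metis assms(1) atLeastLessThan_inj(1) less_add_same_cancel1)
    ultimately show False using fin finite_subset finite_imageD infinite_UNIV_nat by blast
  qed
  then show ?thesis using assms(2) by (meson finite_subset subsetI)
qed

section \<open>Claimed edges and histories of play\<close>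

lemma FP_claimed_Nil [simp]: "FP_claimed [] = {}" and SP_claimed_Nil [simp]: "SP_claimed [] = {}"
  by (auto simp: FP_claimed_def SP_claimed_def)

lemma FP_claimed_snoc:
  "FP_claimed (h @ [x]) = (if even (length h) then insert x (FP_claimed h) else FP_claimed h)"
proof -
  have "(\<exists>i<length (h @ [x]). even i \<and> e = (h @ [x]) ! i) \<longleftrightarrow>
      (even (length h) \<and> e = x) \<or> (\<exists>i<length h. even i \<and> e = h ! i)" for e
    by (simp add: less_Suc_eq nth_append ex_disj_distrib conj_disj_distribR cong: conj_cong) blast
  moreover have "e \<in> FP_claimed l \<longleftrightarrow> (\<exists>i<length l. even i \<and> e = l ! i)" for e l
    by (auto simp: FP_claimed_def)
  ultimately show ?thesis by (intro set_eqI) simp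
qed

lemma SP_claimed_snoc:
  "SP_claimed (h @ [x]) = (if odd (length h) then insert x (SP_claimed h) else SP_claimed h)"
proof -
  have "(\<exists>i<length (h @ [x]). odd i \<and> e = (h @ [x]) ! i) \<longleftrightarrow>
      (odd (length h) \<and> e = x) \<or> (\<exists>i<length h. odd i \<and> e = h ! i)" for e
    by (simp add: less_Suc_eq nth_append ex_disj_distrib conj_disj_distribR cong: conj_cong) blast
  moreover have "e \<in> SP_claimed l \<longleftrightarrow> (\<exists>i<length l. odd i \<and> e = l ! i)" for e l
    by (auto simp: SP_claimed_def)
  ultimately show ?thesis by (intro set_eqI) simp
qed

lemma FP_Un_SP_claimed: "FP_claimed h \<union> SP_claimed h = set h"
  by (induction h rule: rev_induct) (auto simp: FP_claimed_snoc SP_claimed_snoc)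

lemma length_history [simp]: "length (history \<sigma> \<tau> n) = n"
  by (induction n) auto

lemma legal_history_snoc:
  assumes "legal_history k h" "x \<in> board_edges k" "x \<notin> set h"
  shows "legal_history k (h @ [x])"
  using assms by (auto simp: legal_history_def nth_append less_Suc_eq)

lemma legal_history_history:
  assumes "legal_strategy k \<sigma>" "legal_strategy k \<tau>"
  shows "legal_history k (history \<sigma> \<tau> n)"
proof (induction n)
  case 0
  then show ?case by (simp add: legal_history_def)
next
  case (Suc n)
  then show ?case using assms by (auto intro!: legal_history_snoc simp: legal_strategy_def)
qed

lemma history_Suc_free:
  assumes "legal_strategy k \<sigma>" "legal_strategy k \<tau>"
  shows "(if even n then \<sigma> else \<tau>) (history \<sigma> \<tau> n) \<in> board_edges k"
    and "(if even n then \<sigma> else \<tau>) (history \<sigma> \<tau> n) \<notin> set (history \<sigma> \<tau> n)"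
  using legal_history_history[OF assms, of n] assms by (auto simp: legal_strategy_def)

text \<open>The fallback to any free edge makes the strategy legal on every history, also on those
  where \<open>Q\<close> cannot be satisfied.\<close>

definition reply :: "nat \<Rightarrow> (nat set list \<Rightarrow> nat set \<Rightarrow> bool) \<Rightarrow> strategy" where
  "reply k Q h = (if \<exists>y\<in>board_edges k. y \<notin> set h \<and> Q h y
     then SOME y. y \<in> board_edges k \<and> y \<notin> set h \<and> Q h y
     else SOME y. y \<in> board_edges k \<and> y \<notin> set h)"

lemma reply_good:
  assumes "\<exists>y\<in>board_edges k. y \<notin> set h \<and> Q h y"
  shows "Q h (reply k Q h)"
  using assms someI_ex[of "\<lambda>y. y \<in> board_edges k \<and> y \<notin> set h \<and> Q h y"]
  by (auto simp: reply_def)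

lemma legal_reply:
  assumes "k > 0"
  shows "legal_strategy k (reply k Q)"
proof -
  have "reply k Q h \<in> board_edges k \<and> reply k Q h \<notin> set h" for h
    using someI_ex[of "\<lambda>y. y \<in> board_edges k \<and> y \<notin> set h \<and> Q h y"]
      someI_ex[of "\<lambda>y. y \<in> board_edges k \<and> y \<notin> set h"] ex_free_edge[OF assms finite_set, of h]
    by (auto simp: reply_def)
  then show ?thesis by (simp add: legal_strategy_def)
qed

text \<open>Against \<open>reply\<close>, the invariant holds until the supposed win of FP, and it
  forbids exactly the move that completes his copy.\<close>

lemma not_FP_has_winning_strategy:
  assumes "k > 0" "H \<noteq> {}" "drawing_invariant k H P" "P {} {}"
  shows "\<not> FP_has_winning_strategy k H"
proof
  assume "FP_has_winning_strategy k H"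
  then obtain \<sigma> where \<sigma>: "legal_strategy k \<sigma>"
    and win: "\<And>\<tau>. legal_strategy k \<tau> \<Longrightarrow> \<exists>n. FP_wins_at H \<sigma> \<tau> n"
    unfolding FP_has_winning_strategy_def by blast
  let ?Q = "\<lambda>h y. P (FP_claimed h) (insert y (SP_claimed h))"
  define \<tau> where "\<tau> = reply k ?Q"
  have \<tau>: "legal_strategy k \<tau>" unfolding \<tau>_def using assms(1) by (rule legal_reply)
  obtain n where n: "even n" "contains_copy (FP_claimed (history \<sigma> \<tau> (Suc n))) H"
    and before: "\<And>t. t < n \<Longrightarrow> \<not> someone_has_copy H (history \<sigma> \<tau> (Suc t))"
    using win[OF \<tau>] by (auto simp: FP_wins_at_def simp del: history.simps)
  \<comment> \<open>FP is the first to complete a copy, which supplies the premise on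
    \<open>S\<close> in the invariant. The shift to \<open>t - 1\<close> leaves out
    \<open>t = 0\<close>, where nothing is claimed and \<open>H \<noteq> {}\<close> is
    needed.\<close>
  have no_copy: "\<not> contains_copy (SP_claimed (history \<sigma> \<tau> t)) H" if "t \<le> n" for t
    using before[of "t - 1"] not_contains_copy_empty[OF assms(2)] that
    by (cases t) (auto simp: someone_has_copy_def simp del: history.simps(2))
  have step: "\<not> contains_copy (FP_claimed (history \<sigma> \<tau> (Suc (2*i)))) H \<and>
      P (FP_claimed (history \<sigma> \<tau> (2 * Suc i))) (SP_claimed (history \<sigma> \<tau> (2 * Suc i)))"
    if "P (FP_claimed (history \<sigma> \<tau> (2*i))) (SP_claimed (history \<sigma> \<tau> (2*i)))" "2*i \<le> n" for i
  proof -
    let ?h = "history \<sigma> \<tau> (2*i)"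
    let ?x = "\<sigma> ?h"
    have "?x \<in> board_edges k" "?x \<notin> FP_claimed ?h \<union> SP_claimed ?h"
      using history_Suc_free[OF \<sigma> \<tau>, of "2*i"] by (auto simp: FP_Un_SP_claimed)
    then have nc: "\<not> contains_copy (insert ?x (FP_claimed ?h)) H"
      and "\<exists>y\<in>board_edges k. y \<notin> insert ?x (FP_claimed ?h \<union> SP_claimed ?h) \<and>
             P (insert ?x (FP_claimed ?h)) (insert y (SP_claimed ?h))"
      using assms(3) that no_copy[of "2*i"] unfolding drawing_invariant_def by blast+
    then have "\<exists>y\<in>board_edges k. y \<notin> set (?h @ [?x]) \<and> ?Q (?h @ [?x]) y"
      by (auto simp: FP_claimed_snoc SP_claimed_snoc FP_Un_SP_claimed)
    then have "?Q (?h @ [?x]) (\<tau> (?h @ [?x]))" unfolding \<tau>_def by (rule reply_good)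
    then show ?thesis using nc by (simp add: FP_claimed_snoc SP_claimed_snoc del: append_assoc)
  qed
  have inv: "2*i \<le> n \<Longrightarrow> P (FP_claimed (history \<sigma> \<tau> (2*i))) (SP_claimed (history \<sigma> \<tau> (2*i)))" for i
    by (induction i) (use assms(4) step in auto)
  obtain i where "n = 2*i" using n(1) by blast
  then show False using step[OF inv, of i] n(2) by blast
qed

text \<open>The drawing player moves first here, while the invariant describes positions with the
  opponent to move. Hence it starts from one claimed edge, the claimed sets change roles, and it is
  read at odd times.\<close>

lemma not_SP_has_winning_strategy:
  assumes "k > 0" "H \<noteq> {}" "drawing_invariant k H P" "d \<in> board_edges k" "P {} {d}"
  shows "\<not> SP_has_winning_strategy k H"
proof
  assume "SP_has_winning_strategy k H"
  then obtain \<tau> where \<tau>: "legal_strategy k \<tau>"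
    and win: "\<And>\<sigma>. legal_strategy k \<sigma> \<Longrightarrow> \<exists>n. SP_wins_at H \<sigma> \<tau> n"
    unfolding SP_has_winning_strategy_def by blast
  let ?Q = "\<lambda>h y. P (SP_claimed h) (insert y (FP_claimed h))"
  define \<sigma> where "\<sigma> = reply k ?Q"
  have \<sigma>: "legal_strategy k \<sigma>" unfolding \<sigma>_def using assms(1) by (rule legal_reply)
  obtain n where n: "odd n" "contains_copy (SP_claimed (history \<sigma> \<tau> (Suc n))) H"
    and before: "\<And>t. t < n \<Longrightarrow> \<not> someone_has_copy H (history \<sigma> \<tau> (Suc t))"
    using win[OF \<sigma>] by (auto simp: SP_wins_at_def simp del: history.simps)
  have no_copy: "\<not> contains_copy (FP_claimed (history \<sigma> \<tau> t)) H" if "t \<le> n" for t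
    using before[of "t - 1"] not_contains_copy_empty[OF assms(2)] that
    by (cases t) (auto simp: someone_has_copy_def simp del: history.simps(2))
  have step: "\<not> contains_copy (SP_claimed (history \<sigma> \<tau> (Suc (Suc (2*i))))) H \<and>
      P (SP_claimed (history \<sigma> \<tau> (Suc (2 * Suc i)))) (FP_claimed (history \<sigma> \<tau> (Suc (2 * Suc i))))"
    if "P (SP_claimed (history \<sigma> \<tau> (Suc (2*i)))) (FP_claimed (history \<sigma> \<tau> (Suc (2*i))))"
      "Suc (2*i) \<le> n" for i
  proof -
    define h where "h = history \<sigma> \<tau> (Suc (2*i))"
    have len: "length h = Suc (2*i)" by (simp add: h_def del: history.simps)
    let ?x = "\<tau> h"
    have "?x \<in> board_edges k" "?x \<notin> SP_claimed h \<union> FP_claimed h"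
      using history_Suc_free[OF \<sigma> \<tau>, of "Suc (2*i)"] FP_Un_SP_claimed[of h]
      by (auto simp: h_def simp del: history.simps)
    then have nc: "\<not> contains_copy (insert ?x (SP_claimed h)) H"
      and "\<exists>y\<in>board_edges k. y \<notin> insert ?x (SP_claimed h \<union> FP_claimed h) \<and>
             P (insert ?x (SP_claimed h)) (insert y (FP_claimed h))"
      using assms(3) that no_copy[of "Suc (2*i)"] unfolding drawing_invariant_def h_def by blast+
    then have "\<exists>y\<in>board_edges k. y \<notin> set (h @ [?x]) \<and> ?Q (h @ [?x]) y"
      using FP_Un_SP_claimed[of h] by (auto simp: FP_claimed_snoc SP_claimed_snoc len)
    then have Q: "?Q (h @ [?x]) (\<sigma> (h @ [?x]))" unfolding \<sigma>_def by (rule reply_good)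
    have hist: "history \<sigma> \<tau> (Suc (Suc (2*i))) = h @ [?x]"
      "history \<sigma> \<tau> (Suc (2 * Suc i)) = (h @ [?x]) @ [\<sigma> (h @ [?x])]"
      by (simp_all add: h_def)
    show ?thesis using nc Q unfolding hist by (simp add: FP_claimed_snoc SP_claimed_snoc len del: append_assoc)
  qed
  have base: "P (SP_claimed (history \<sigma> \<tau> (Suc (2*0)))) (FP_claimed (history \<sigma> \<tau> (Suc (2*0))))"
  proof -
    \<comment> \<open>\<open>d\<close> only witnesses that a suitable opening edge exists;
      \<open>\<sigma>\<close> may choose another one.\<close>
    have "?Q [] (\<sigma> [])" unfolding \<sigma>_def by (rule reply_good) (use assms(4,5) in auto)
    then show ?thesis using FP_claimed_snoc[of "[]"] SP_claimed_snoc[of "[]"] by simp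
  qed
  have inv: "P (SP_claimed (history \<sigma> \<tau> (Suc (2*i)))) (FP_claimed (history \<sigma> \<tau> (Suc (2*i))))"
    if "Suc (2*i) \<le> n" for i using that
  proof (induction i)
    case 0
    show ?case using base by blast
  next
    case (Suc i)
    then show ?case using step[of i] by simp
  qed
  obtain i where "n = Suc (2*i)" using n(1) by (auto elim: oddE)
  then show False using step[OF inv, of i] n(2) by blast
qed

section \<open>Rigid cores\<close>

text \<open>Everything outside \<open>U\<close> is shifted past a bound on the old images and on
  \<open>X\<close>. In the opening this sends the new vertices of an edge to places that no claimed
  edge touches.\<close>

lemma inj_on_extend_fresh:
  fixes f :: "nat \<Rightarrow> nat"
  assumes "inj_on f U" "finite U" "finite X"
  shows "\<exists>g. inj_on g (U \<union> W) \<and> (\<forall>u\<in>U. g u = f u) \<and> (\<forall>w\<in>W - U. g w \<notin> X)"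
proof -
  obtain N where N: "\<forall>n\<in>f ` U \<union> X. n < N"
    using assms(2,3) by (metis finite_UnI finite_imageI finite_nat_set_iff_bounded)
  define g where "g u = (if u \<in> U then f u else u + N)" for u
  have "inj_on g (U \<union> W)"
  proof (rule inj_onI)
    fix a b assume eq: "g a = g b"
    have neq: "f u \<noteq> w + N" if "u \<in> U" for u w
      using N that by (metis UnI1 imageI not_add_less2)
    show "a = b"
      using eq inj_onD[OF assms(1), of a b] neq[of a b] neq[of b a] unfolding g_def
      by (cases "a \<in> U"; cases "b \<in> U") auto
  qed
  moreover have "g w \<notin> X" if "w \<in> W - U" for w
    using that N unfolding g_def by (metis DiffD2 UnCI not_add_less2)
  ultimately show ?thesis by (intro exI[of _ g]) (auto simp: g_def)
qed

definition core_copy :: "nat set set \<Rightarrow> (nat \<Rightarrow> nat) \<Rightarrow> nat set set" where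
  "core_copy C f = (`) f ` C"

text \<open>The apex is a separate argument, not a value of \<open>f\<close>, since the game
  compares full copies with one core and many apexes.\<close>

definition full_copy ::
    "nat set set \<Rightarrow> nat set \<Rightarrow> nat set \<Rightarrow> (nat \<Rightarrow> nat) \<Rightarrow> nat \<Rightarrow> nat set set" where
  "full_copy C R G f z = insert (insert z (f ` R)) (insert (insert z (f ` G)) (core_copy C f))"

text \<open>\<open>degree3_meet\<close> rules out a second core of the opponent in which the apex of the first one
  plays the role of a vertex of degree 3. \<open>almost_rigid\<close> allows the symmetric alternatives of the
  last two edges, which do change the spots, but never to a pair that meets like \<open>R\<close> and \<open>G\<close>.\<close>

locale rigid_core =
  fixes k :: nat and C :: "nat set set" and R G :: "nat set" and \<zeta> :: nat
    and es :: "nat set list" and s1 s1' s2 s2' :: "nat set" and v :: nat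
  assumes k_pos: "k > 0"
    and card_edge: "\<And>e. e \<in> C \<Longrightarrow> card e = k"
    and card_spot: "card R = k - 1" "card G = k - 1"
    and spots: "R \<subseteq> \<Union>C" "G \<subseteq> \<Union>C" "R \<noteq> G" "\<zeta> \<notin> \<Union>C"
    and degree4: "\<And>u. u \<in> \<Union>C \<Longrightarrow>
      card {e \<in> C. u \<in> e} + of_bool (u \<in> R) + of_bool (u \<in> G) \<ge> 4"
    and degree3: "\<And>u. u \<in> \<Union>C \<Longrightarrow> card {e \<in> C. u \<in> e} \<ge> 3"
    and degree3_meet: "\<And>u e e'. card {e \<in> C. u \<in> e} = 3 \<Longrightarrow> e \<in> C \<Longrightarrow> e' \<in> C \<Longrightarrow>
      u \<in> e \<Longrightarrow> u \<in> e' \<Longrightarrow> e \<noteq> e' \<Longrightarrow> card (e \<inter> e') \<noteq> Suc (card (R \<inter> G))"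
    and rigid: "\<And>f f' z z'. inj_on f (\<Union>C) \<Longrightarrow> inj_on f' (\<Union>C) \<Longrightarrow>
      z \<notin> f ` \<Union>C \<Longrightarrow> z' \<notin> f' ` \<Union>C \<Longrightarrow>
      card C \<le> card (full_copy C R G f z \<inter> full_copy C R G f' z') \<Longrightarrow> u \<in> \<Union>C \<Longrightarrow> f u = f' u"
    and almost_rigid: "\<And>f f'. inj_on f (\<Union>C) \<Longrightarrow> inj_on f' (\<Union>C) \<Longrightarrow>
      card C \<le> Suc (card (core_copy C f \<inter> core_copy C f')) \<Longrightarrow>
      f ` R = f' ` R \<and> f ` G = f' ` G \<or>
      card (R \<inter> G) \<notin> {card (f ` R \<inter> f' ` R), card (f ` R \<inter> f' ` G),
        card (f ` G \<inter> f' ` R), card (f ` G \<inter> f' ` G)}"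
    and C_eq: "C = insert s1 (insert s2 (set es))"
    and card_C: "card C = length es + 2"
    and es_fresh: "\<And>j. j < length es \<Longrightarrow> \<not> es ! j \<subseteq> \<Union>(set (take j es))"
    and v_fresh: "es \<noteq> []" "v \<in> last es" "v \<notin> \<Union>(set (butlast es))"
    and closers: "s1 \<noteq> s1'" "s2 \<noteq> s2'" "{s1, s1'} \<inter> {s2, s2'} = {}"
      "last es \<notin> {s1, s1', s2, s2'}" "v \<in> s1 \<inter> s1' \<inter> s2 \<inter> s2'"
      "s1 \<union> s1' \<union> s2 \<union> s2' \<subseteq> \<Union>(set es)"
    and closers_symmetric: "\<And>a b. a \<in> {s1, s1'} \<Longrightarrow> b \<in> {s2, s2'} \<Longrightarrow>
      \<exists>\<rho>. inj_on \<rho> (\<Union>C) \<and> \<rho> ` \<Union>C \<subseteq> \<Union>C \<and> (\<forall>e\<in>set es. \<rho> ` e = e) \<and> \<rho> ` s1 = a \<and> \<rho> ` s2 = b"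
begin

abbreviation V where "V \<equiv> \<Union>C"
abbreviation core where "core \<equiv> core_copy C"
abbreviation full where "full \<equiv> full_copy C R G"

definition target :: "nat set set" where
  "target = insert (insert \<zeta> R) (insert (insert \<zeta> G) C)"

section \<open>Copies of the core and of the target\<close>

lemma finite_C: "finite C" by (simp add: C_eq)

lemma finite_edge: "e \<in> C \<Longrightarrow> finite e"
  using card_edge k_pos card_gt_0_iff by metis

lemma finite_V: "finite V" using finite_C finite_edge by blast

lemma finite_core: "finite (core f)" by (simp add: core_copy_def finite_C)

lemma finite_full: "finite (full f z)" by (simp add: full_copy_def finite_core)

lemma V_eq: "V = \<Union>(set es)" using closers(6) by (auto simp: C_eq)

lemma inj_on_image_C: "inj_on f V \<Longrightarrow> inj_on ((`) f) C"
  by (rule inj_onI) (metis Union_upper inj_on_image_eq_iff)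

lemma card_core: "inj_on f V \<Longrightarrow> card (core f) = card C"
  by (simp add: core_copy_def card_image inj_on_image_C)

lemma core_subset: "e \<in> core f \<Longrightarrow> e \<subseteq> f ` V" by (auto simp: core_copy_def)

lemma spot_images_subset: "f ` R \<subseteq> f ` V" "f ` G \<subseteq> f ` V" using spots by blast+

lemma spot_images_neq: "inj_on f V \<Longrightarrow> f ` R \<noteq> f ` G"
  using spots inj_on_image_eq_iff by metis

lemma link_edges:
  assumes "inj_on f V" "z \<notin> f ` V"
  shows "insert z (f ` R) \<noteq> insert z (f ` G)"
    "insert z (f ` R) \<notin> core f" "insert z (f ` G) \<notin> core f"
proof -
  show "insert z (f ` R) \<noteq> insert z (f ` G)"
    using spot_images_neq[OF assms(1)] assms(2) spot_images_subset by (metis insert_ident subsetD)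
  show "insert z (f ` R) \<notin> core f" "insert z (f ` G) \<notin> core f"
    using assms(2) core_subset by blast+
qed

lemma card_full: "inj_on f V \<Longrightarrow> z \<notin> f ` V \<Longrightarrow> card (full f z) = card C + 2"
  by (simp add: full_copy_def link_edges finite_core card_core)

lemma core_subset_full: "core f \<subseteq> full f z" by (auto simp: full_copy_def)

lemma core_cong: "(\<And>u. u \<in> V \<Longrightarrow> f u = f' u) \<Longrightarrow> core f = core f'"
  unfolding core_copy_def by (intro image_cong refl) auto

lemma spot_cong:
  assumes "\<And>u. u \<in> V \<Longrightarrow> f u = f' u"
  shows "f ` R = f' ` R" "f ` G = f' ` G"
  by (intro image_cong refl assms subsetD[OF spots(1)] subsetD[OF spots(2)]; assumption)+

lemma finite_spots: "finite R" "finite G"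
  using spots finite_V finite_subset by blast+

lemma full_board:
  assumes "inj_on f V" "z \<notin> f ` V"
  shows "full f z \<subseteq> board_edges k"
proof -
  have "card (f ` e) = k \<and> finite (f ` e)" if "e \<in> C" for e
    using that assms(1) card_edge finite_edge
    by (metis Union_upper card_image finite_imageI inj_on_subset)
  moreover have "card (insert z (f ` X)) = k" if "X \<subseteq> V" "card X = k - 1" for X
  proof -
    have "card (f ` X) = k - 1" using that assms(1) by (metis card_image inj_on_subset)
    moreover have "finite (f ` X)" using that finite_V finite_subset by blast
    moreover have "z \<notin> f ` X" using that assms(2) by blast
    ultimately show ?thesis using k_pos by simp
  qed
  ultimately show ?thesis
    using spots card_spot finite_spots by (auto simp: full_copy_def core_copy_def board_edges_def)
qed

text \<open>As \<open>\<zeta>\<close> lies outside the core, an embedding of the target splits into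
  its restriction to \<open>V\<close> and a freely chosen image of \<open>\<zeta>\<close>.\<close>

lemma contains_target_iff:
  "contains_copy A target \<longleftrightarrow> (\<exists>f z. inj_on f V \<and> z \<notin> f ` V \<and> full f z \<subseteq> A)"
proof
  have U: "\<Union>target = insert \<zeta> V" unfolding target_def using spots(1,2) by blast
  show "\<exists>f z. inj_on f V \<and> z \<notin> f ` V \<and> full f z \<subseteq> A" if copy: "contains_copy A target"
  proof -
    obtain f where f: "inj_on f (insert \<zeta> V)" "\<forall>e\<in>target. f ` e \<in> A"
      using copy unfolding contains_copy_def U by (elim exE conjE)
    have "full f (f \<zeta>) \<subseteq> A"
      using f(2) unfolding full_copy_def core_copy_def target_def by (simp add: image_subset_iff)
    moreover have "inj_on f V" "f \<zeta> \<notin> f ` V"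
      using f(1) spots(4) by (simp_all add: inj_on_insert)
    ultimately show ?thesis by blast
  qed
  show "contains_copy A target" if copy: "\<exists>f z. inj_on f V \<and> z \<notin> f ` V \<and> full f z \<subseteq> A"
  proof -
    obtain f z where f: "inj_on f V" "z \<notin> f ` V" "full f z \<subseteq> A" using copy by blast
    let ?g = "f(\<zeta> := z)"
    have pt: "?g u = f u" if "u \<in> V" for u using that spots(4) by auto
    have same: "?g ` X = f ` X" if "X \<subseteq> V" for X
      using that pt by (intro image_cong) blast+
    have "inj_on ?g V" using f(1) pt inj_on_cong by metis
    then have "inj_on ?g (insert \<zeta> V)"
      using f(2) same[OF subset_refl] spots(4) by (simp add: inj_on_insert)
    moreover have "?g ` e \<in> A" if "e \<in> target" for e
    proof -
      have "?g ` insert \<zeta> R = insert z (f ` R)" "?g ` insert \<zeta> G = insert z (f ` G)"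
        using same[OF spots(1)] same[OF spots(2)] by (simp_all del: fun_upd_apply add: fun_upd_same)
      moreover have "?g ` e = f ` e" if "e \<in> C" using same that by blast
      ultimately show ?thesis
        using f(3) that unfolding target_def full_copy_def core_copy_def by auto
    qed
    ultimately show ?thesis unfolding contains_copy_def U by blast
  qed
qed

section \<open>Degrees of vertices in copies\<close>

lemma degree_core:
  assumes "inj_on f V" "u \<in> V"
  shows "card {e \<in> core f. f u \<in> e} = card {e \<in> C. u \<in> e}"
proof -
  have "{e \<in> core f. f u \<in> e} = (`) f ` {e \<in> C. u \<in> e}"
    using assms by (auto simp: core_copy_def inj_on_def; blast)
  moreover have "inj_on ((`) f) {e \<in> C. u \<in> e}"
    using inj_on_image_C[OF assms(1)] by (rule inj_on_subset) blast
  ultimately show ?thesis by (simp add: card_image)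
qed

lemma degree_core_ge:
  assumes "inj_on f V" "w \<in> f ` V"
  shows "card {e \<in> core f. w \<in> e} \<ge> 3"
proof -
  obtain u where "u \<in> V" "w = f u" using assms(2) by (rule imageE)
  then show ?thesis using degree_core[OF assms(1), of u] degree3[of u] by simp
qed

lemma degree_full_ge:
  assumes "inj_on f V" "z \<notin> f ` V" "w \<in> f ` V"
  shows "card {e \<in> full f z. w \<in> e} \<ge> 4"
proof -
  obtain u where u: "u \<in> V" "w = f u" using assms(3) by (rule imageE)
  have mem: "w \<in> f ` R \<longleftrightarrow> u \<in> R" "w \<in> f ` G \<longleftrightarrow> u \<in> G"
    using u assms(1) spots inj_on_image_mem_iff by metis+
  have wz: "w \<noteq> z" using assms by blast
  let ?r = "insert z (f ` R)" and ?g = "insert z (f ` G)"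
  let ?D = "{e \<in> core f. w \<in> e}"
  have "{e \<in> full f z. w \<in> e} = ?D \<union> (if u \<in> R then {?r} else {}) \<union> (if u \<in> G then {?g} else {})"
    using mem wz by (auto simp: full_copy_def)
  moreover have "card \<dots> = card ?D + of_bool (u \<in> R) + of_bool (u \<in> G)"
    using link_edges[OF assms(1,2)] finite_core by (auto simp: card_insert_if)
  ultimately show ?thesis using degree4[OF u(1)] degree_core[OF assms(1) u(1)] u(2) by simp
qed

lemma full_edges_at_apex:
  assumes "z \<notin> f ` V"
  shows "{e \<in> full f z. z \<in> e} = {insert z (f ` R), insert z (f ` G)}"
proof -
  have "z \<notin> e" if "e \<in> core f" for e using core_subset[OF that] assms by (rule contra_subsetD)
  then show ?thesis by (auto simp: full_copy_def)
qed

text \<open>All vertices of a full copy except its apex have degree at least 4, so a vertex on at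
  most three edges of \<open>A\<close> has no other place in the copy. This keeps fresh vertices out
  of its core.\<close>

lemma low_degree_apex:
  assumes "inj_on f V" "z \<notin> f ` V" "full f z \<subseteq> A" "finite {e \<in> A. w \<in> e}"
    "card {e \<in> A. w \<in> e} \<le> 3" "e \<in> full f z" "w \<in> e"
  shows "w = z"
proof (rule ccontr)
  assume "w \<noteq> z"
  then consider "e \<in> core f" | "w \<in> f ` R" | "w \<in> f ` G"
    using assms(6,7) by (auto simp: full_copy_def)
  then have "w \<in> f ` V"
    by cases (use assms(7) core_subset spot_images_subset in \<open>metis subsetD\<close>)+
  then have "4 \<le> card {e \<in> full f z. w \<in> e}" by (rule degree_full_ge[OF assms(1,2)])
  also have "\<dots> \<le> card {e \<in> A. w \<in> e}" using assms(3,4) by (intro card_mono) auto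
  finally show False using assms(5) by simp
qed

lemma low_degree_core:
  assumes "inj_on f V" "core f \<subseteq> A" "finite {e \<in> A. w \<in> e}" "card {e \<in> A. w \<in> e} \<le> 2"
  shows "w \<notin> f ` V"
proof
  assume "w \<in> f ` V"
  then have "3 \<le> card {e \<in> core f. w \<in> e}" by (rule degree_core_ge[OF assms(1)])
  also have "\<dots> \<le> card {e \<in> A. w \<in> e}" using assms(2,3) by (intro card_mono) auto
  finally show False using assms(4) by simp
qed

section \<open>Answered threats\<close>

definition answered :: "(nat \<Rightarrow> nat) \<Rightarrow> nat set set \<Rightarrow> nat set \<Rightarrow> bool" where
  "answered f S t \<longleftrightarrow> (\<exists>z. z \<notin> f ` V \<and>
     (t = insert z (f ` R) \<and> insert z (f ` G) \<in> S \<or> t = insert z (f ` G) \<and> insert z (f ` R) \<in> S))"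

lemma answered_mono: "answered f S t \<Longrightarrow> S \<subseteq> S' \<Longrightarrow> answered f S' t"
  by (auto simp: answered_def)

lemma answeredD:
  assumes "answered f S t" "z \<in> t" "z \<notin> f ` V"
  shows "t = insert z (f ` R) \<and> insert z (f ` G) \<in> S \<or> t = insert z (f ` G) \<and> insert z (f ` R) \<in> S"
proof -
  obtain z' where z': "t = insert z' (f ` R) \<and> insert z' (f ` G) \<in> S \<or>
      t = insert z' (f ` G) \<and> insert z' (f ` R) \<in> S"
    using assms(1) unfolding answered_def by blast
  moreover have "z \<notin> f ` R" "z \<notin> f ` G"
    using assms(3) spot_images_subset by (meson subsetD)+
  ultimately have "z = z'" using assms(2) by auto
  then show ?thesis using z' by simp
qed

text \<open>Two different such edges through \<open>z\<close> would each be the other's answer, so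
  both would lie in \<open>S\<close>.\<close>

lemma answered_unique:
  assumes "answered f S t" "answered f S t'" "t \<notin> S" "z \<in> t" "z \<in> t'" "z \<notin> f ` V"
  shows "t = t'"
  using answeredD[OF assms(1,4,6)] answeredD[OF assms(2,5,6)] assms(3) by auto

lemma answered_apex:
  assumes "answered f S t"
  obtains z where "z \<in> t" "z \<notin> f ` V"
  using assms unfolding answered_def by blast

text \<open>However many threats have been answered, the opponent keeps a single edge at each apex;
  only \<open>X\<close> can add to its degree.\<close>

lemma answered_degree:
  assumes "\<forall>t\<in>T. answered f S t" "T \<inter> S = {}" "z \<notin> f ` V" "t \<in> T" "z \<in> t"
  shows "{e \<in> core f \<union> T \<union> X. z \<in> e} \<subseteq> insert t X"
proof
  fix e assume e: "e \<in> {e \<in> core f \<union> T \<union> X. z \<in> e}"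
  have "e \<notin> core f" using e assms(3) core_subset by (metis (no_types, lifting) mem_Collect_eq subsetD)
  moreover have "e = t" if "e \<in> T"
    using answered_unique[of f S e t z] assms e that by auto
  ultimately show "e \<in> insert t X" using e by auto
qed

text \<open>A full copy has \<open>card C + 2\<close> edges, so without \<open>x\<close> and
  \<open>y\<close> it keeps the \<open>card C\<close> edges that \<open>rigid\<close> asks for;
  \<open>x = y\<close> is allowed.\<close>

lemma almost_full_rigid:
  assumes "inj_on f V" "inj_on f2 V" "z \<notin> f ` V" "z2 \<notin> f2 ` V"
    and sub: "full f2 z2 - {x, y} \<subseteq> full f z" and u: "u \<in> V"
  shows "f u = f2 u"
proof (rule rigid[OF assms(1-4) _ u])
  have "card C + 2 - card {x, y} \<le> card (full f2 z2 - {x, y})"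
    using diff_card_le_card_Diff[of "{x, y}" "full f2 z2"] card_full[OF assms(2,4)] by simp
  moreover have "card {x, y} \<le> 2" by (simp add: card_insert_if)
  moreover have "card (full f2 z2 - {x, y}) \<le> card (full f z \<inter> full f2 z2)"
    using sub finite_full by (intro card_mono) auto
  ultimately show "card C \<le> card (full f z \<inter> full f2 z2)" by linarith
qed

text \<open>An answered edge \<open>t\<close> in the new copy has an apex lying on at most three
  edges, namely \<open>t\<close>, \<open>x\<close> and \<open>y\<close>, so this apex must be
  \<open>z2\<close>. Hence at most one answered edge is used, everything except \<open>x\<close> and
  \<open>y\<close> lies in one full copy over \<open>f\<close>, and rigidity applies.\<close>

lemma full_in_answered:
  assumes f: "inj_on f V" and T: "\<forall>t\<in>T. answered f S t" "T \<inter> S = {}"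
    and f2: "inj_on f2 V" "z2 \<notin> f2 ` V"
    and sub: "full f2 z2 \<subseteq> core f \<union> T \<union> {x, y}" and u: "u \<in> V"
  shows "f u = f2 u"
proof -
  have apex: "z = z2" if "t \<in> T" "t \<in> full f2 z2" "z \<in> t" "z \<notin> f ` V" for t z
  proof (rule low_degree_apex[OF f2 sub _ _ that(2,3)])
    have le: "{e \<in> core f \<union> T \<union> {x, y}. z \<in> e} \<subseteq> {t, x, y}"
      using answered_degree[OF T that(4,1,3)] .
    then show "finite {e \<in> core f \<union> T \<union> {x, y}. z \<in> e}" using finite_subset by blast
    have "card {e \<in> core f \<union> T \<union> {x, y}. z \<in> e} \<le> card {t, x, y}"
      using le by (intro card_mono) auto
    also have "\<dots> \<le> 3" by (simp add: card_insert_if)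
    finally show "card {e \<in> core f \<union> T \<union> {x, y}. z \<in> e} \<le> 3" .
  qed
  have "\<exists>z. z \<notin> f ` V \<and> full f2 z2 - {x, y} \<subseteq> full f z"
  proof (cases "T \<inter> full f2 z2 = {}")
    case True
    \<comment> \<open>Without answered edges the remaining edges lie in the core, and any apex will
      do.\<close>
    obtain z where "z \<notin> f ` V" using finite_V by (meson ex_new_if_finite finite_imageI infinite_UNIV_nat)
    then show ?thesis using True sub core_subset_full by blast
  next
    case False
    then obtain t where t: "t \<in> T" "t \<in> full f2 z2" by blast
    obtain z where z: "z \<in> t" "z \<notin> f ` V" by (rule answered_apex[OF bspec[OF T(1) t(1)]])
    have "t' = t" if t': "t' \<in> T" "t' \<in> full f2 z2" for t'
    proof -
      obtain z' where z': "z' \<in> t'" "z' \<notin> f ` V"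
        by (rule answered_apex[OF bspec[OF T(1) t'(1)]])
      have "z' = z" using apex[OF t' z'] apex[OF t z] by simp
      moreover have "t' \<notin> S" using T(2) t'(1) by blast
      ultimately show ?thesis
        using answered_unique[OF bspec[OF T(1) t'(1)] bspec[OF T(1) t(1)]] z z' by simp
    qed
    then have "full f2 z2 - {x, y} \<subseteq> insert t (core f)" using sub by blast
    moreover have "t \<in> full f z"
      using answeredD[OF bspec[OF T(1) t(1)] z] by (auto simp: full_copy_def)
    ultimately have "full f2 z2 - {x, y} \<subseteq> full f z" using core_subset_full[of f z] by blast
    then show ?thesis using z(2) by (intro exI[of _ z]) simp
  qed
  then obtain z where "z \<notin> f ` V" "full f2 z2 - {x, y} \<subseteq> full f z" by (elim exE conjE)
  then show ?thesis by (intro almost_full_rigid[OF f f2(1) _ f2(2) _ u])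
qed

section \<open>The race after the drawing player has his core\<close>

text \<open>The positions, with the opponent to move, in which the drawing player already owns a core and
  is parrying threats: either no threat has occurred yet, or the opponent completed a core and all
  his further edges were answered, or his first threat was parried inside the core.\<close>

definition core_race :: "nat set set \<Rightarrow> nat set set \<Rightarrow> bool" where
  "core_race F S \<longleftrightarrow>
     card F = card C \<or>
     (\<exists>f T. inj_on f V \<and> F = core f \<union> T \<and> (\<forall>t\<in>T. answered f S t)) \<or>
     (\<exists>f z e. inj_on f V \<and> z \<notin> f ` V \<and> F = full f z - {e} \<and> e \<in> core f \<inter> S)"

lemma core_race_cases:
  assumes "core_race F S"
  obtains (balanced) "card F = card C"
  | (threats) f T where "inj_on f V" "F = core f \<union> T" "\<forall>t\<in>T. answered f S t"
  | (spoiled) f z e where "inj_on f V" "z \<notin> f ` V" "F = full f z - {e}" "e \<in> core f" "e \<in> S"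
  using assms unfolding core_race_def by blast

text \<open>Counting leaves no idle edge: the copy has \<open>card C + 2\<close> edges, and that
  many are available only if \<open>y\<close> is new and all of them are used. If \<open>y\<close>
  lies in the core, the copy is spoiled; otherwise \<open>y\<close> answers the one link edge that
  the opponent owns.\<close>

lemma core_race_balanced_step:
  assumes "finite F" "card F = card C" and f: "inj_on f V" "z \<notin> f ` V"
    and sub: "full f z \<subseteq> insert y (insert x F)"
  shows "y \<notin> insert x F \<and> core_race (insert x F) (insert y S)"
proof -
  have fin: "finite (insert y (insert x F))" using assms(1) by simp
  have "card (insert y (insert x F)) \<le> card (full f z)"
    using assms(1,2) card_full[OF f] by (simp add: card_insert_if)
  then have eq: "full f z = insert y (insert x F)"
    using card_seteq[OF fin sub] by simp
  have y: "y \<notin> insert x F"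
  proof
    assume "y \<in> insert x F"
    then have "card (full f z) = card (insert x F)" using eq by (simp add: insert_absorb)
    then show False using assms(1,2) card_full[OF f] by (simp add: card_insert_if split: if_splits)
  qed
  have eq': "insert x F = full f z - {y}" using eq y by blast
  have yf: "y \<in> full f z" using eq by blast
  let ?r = "insert z (f ` R)" and ?g = "insert z (f ` G)"
  have "core_race (insert x F) (insert y S)"
  proof (cases "y \<in> core f")
    case True
    then have "y \<in> core f \<inter> insert y S" by simp
    then show ?thesis using f eq' unfolding core_race_def by metis
  next
    case False
    then have "\<exists>t. insert x F = core f \<union> {t} \<and> answered f (insert y S) t"
    proof (cases "y = ?r")
      case True
      have "insert x F = core f \<union> {?g}"
        unfolding eq' True using link_edges[OF f] by (auto simp: full_copy_def)
      moreover have "answered f (insert y S) ?g" unfolding answered_def True using f(2) by blast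
      ultimately show ?thesis by (intro exI conjI)
    next
      case False
      then have yg: "y = ?g" using yf \<open>y \<notin> core f\<close> by (auto simp: full_copy_def)
      have "insert x F = core f \<union> {?r}"
        unfolding eq' yg using link_edges[OF f] by (auto simp: full_copy_def)
      moreover have "answered f (insert y S) ?r" unfolding answered_def yg using f(2) by blast
      ultimately show ?thesis by (intro exI conjI)
    qed
    then obtain t where "insert x F = core f \<union> {t}" "\<forall>t\<in>{t}. answered f (insert y S) t" by auto
    then show ?thesis unfolding core_race_def using f(1) by metis
  qed
  then show ?thesis using y by simp
qed

text \<open>The new copy has the core of the old ones, so the question is only where its two link
  edges come from. Neither lies in \<open>T\<close>, since its partner would then belong to
  \<open>S\<close>; so they are \<open>x\<close> and \<open>y\<close>.\<close>

lemma core_race_threats_step: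
  assumes f: "inj_on f V" and T: "\<forall>t\<in>T. answered f S t" and F: "F = core f \<union> T" "F \<inter> S = {}"
    and x: "x \<notin> F \<union> S" and y: "y \<notin> S"
    and f2: "inj_on f2 V" "z2 \<notin> f2 ` V" and sub: "full f2 z2 \<subseteq> insert y (insert x F)"
  shows "y \<notin> insert x F \<and> core_race (insert x F) (insert y S)"
proof -
  have TS: "T \<inter> S = {}" using F by blast
  have sub': "full f2 z2 \<subseteq> core f \<union> T \<union> {x, y}" using sub F(1) by blast
  have eq: "f u = f2 u" if "u \<in> V" for u
    using full_in_answered[OF f T TS f2 sub' that] .
  have eqs: "f ` V = f2 ` V" "core f = core f2" "f ` R = f2 ` R" "f ` G = f2 ` G"
    by (rule image_cong[OF refl eq], assumption)
      (rule core_cong[OF eq] spot_cong(1)[OF eq] spot_cong(2)[OF eq], assumption)+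
  define r g where rg: "r = insert z2 (f ` R)" "g = insert z2 (f ` G)"
  have z2: "z2 \<notin> f ` V" using f2(2) eqs(1) by simp
  have mem: "r \<in> insert y (insert x F)" "g \<in> insert y (insert x F)"
    using sub by (auto simp: full_copy_def rg eqs)
  then have notS: "r \<notin> S" "g \<notin> S" using F(2) x y by blast+
  have "r \<noteq> g" "r \<notin> core f" "g \<notin> core f" using link_edges[OF f z2] by (simp_all add: rg)
  moreover have "t \<notin> T" if "t \<in> {r, g}" for t
  proof
    assume "t \<in> T"
    moreover have "z2 \<in> t" using that by (auto simp: rg)
    ultimately have "t = r \<and> g \<in> S \<or> t = g \<and> r \<in> S"
      using answeredD[of f S t z2] T z2 by (auto simp: rg)
    then show False using notS by blast
  qed
  ultimately have xy: "r = x \<and> g = y \<or> r = y \<and> g = x" using mem F(1) by blast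
  then have "y \<notin> insert x F"
    using \<open>r \<noteq> g\<close> \<open>r \<notin> core f\<close> \<open>g \<notin> core f\<close> \<open>\<And>t. t \<in> {r, g} \<Longrightarrow> t \<notin> T\<close> F(1) by auto
  moreover have "answered f (insert y S) x"
    unfolding answered_def using xy z2 by (auto simp: rg)
  then have "\<forall>t\<in>insert x T. answered f (insert y S) t"
    using T answered_mono[of f S _ "insert y S"] by blast
  then have "core_race (insert x F) (insert y S)"
    unfolding core_race_def using f F(1) by (metis Un_insert_right)
  ultimately show ?thesis by simp
qed

text \<open>By rigidity a new copy would need the same core, and that contains the edge
  \<open>e\<close> lost to \<open>S\<close>.\<close>

lemma core_race_spoiled_step:
  assumes f: "inj_on f V" "z \<notin> f ` V" and e: "e \<in> core f" "e \<in> S"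
    and x: "x \<notin> S" and y: "y \<notin> S"
    and f2: "inj_on f2 V" "z2 \<notin> f2 ` V"
    and sub: "full f2 z2 \<subseteq> insert y (insert x (full f z - {e}))"
  shows False
proof -
  have "full f2 z2 - {x, y} \<subseteq> full f z" using sub by blast
  then have "core f = core f2"
    by (intro core_cong almost_full_rigid[OF f(1) f2(1) f(2) f2(2)])
  then have "e \<in> insert y (insert x (full f z - {e}))"
    using subset_trans[OF core_subset_full sub] e(1) by (metis subsetD)
  then show False using e(2) x y by auto
qed

lemma core_race_step:
  assumes "core_race F S" "finite F" "F \<inter> S = {}" "x \<notin> F \<union> S" "y \<notin> S"
    and f2: "inj_on f2 V" "z2 \<notin> f2 ` V" and sub: "full f2 z2 \<subseteq> insert y (insert x F)"
  shows "y \<notin> insert x F \<and> core_race (insert x F) (insert y S)"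
  using assms(1)
proof (cases rule: core_race_cases)
  case balanced
  then show ?thesis using core_race_balanced_step[OF assms(2) _ f2 sub] by blast
next
  case (threats f T)
  then show ?thesis using core_race_threats_step[OF threats(1,3,2) assms(3-5) f2 sub] by blast
next
  case (spoiled f z e)
  have "x \<notin> S" using assms(4) by simp
  then show ?thesis
    using core_race_spoiled_step[OF spoiled(1,2,4,5) _ assms(5) f2] sub spoiled(3) by blast
qed

text \<open>Two cores inside a set of \<open>card C + 1\<close> edges share all but at most one
  edge, which is what \<open>almost_rigid\<close> needs. Answered edges are left out of
  \<open>A\<close> because their apex has degree at most 2, too little for a core vertex.\<close>

lemma core_race_cores:
  assumes "core_race F S" "finite F" "F \<inter> S = {}" "x \<notin> F \<union> S"
  shows "\<exists>A. finite A \<and> card A \<le> Suc (card C) \<and>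
    (\<forall>f2. inj_on f2 V \<longrightarrow> core f2 \<subseteq> insert x F \<longrightarrow> core f2 \<subseteq> A)"
  using assms(1)
proof (cases rule: core_race_cases)
  case balanced
  then show ?thesis using assms(2) by (intro exI[of _ "insert x F"]) (auto simp: card_insert_if)
next
  case (threats f T)
  have "core f2 \<subseteq> insert x (core f)" if f2: "inj_on f2 V" "core f2 \<subseteq> insert x F" for f2
  proof
    fix t assume t: "t \<in> core f2"
    show "t \<in> insert x (core f)"
    proof (rule ccontr)
      assume "t \<notin> insert x (core f)"
      then have tT: "t \<in> T" using t f2(2) threats(2) by blast
      obtain z where z: "z \<in> t" "z \<notin> f ` V" by (rule answered_apex[OF bspec[OF threats(3) tT]])
      have TS: "T \<inter> S = {}" using assms(3) threats(2) by blast
      have le: "{e \<in> core f \<union> T \<union> {x}. z \<in> e} \<subseteq> {t, x}"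
        by (rule answered_degree[OF threats(3) TS z(2) tT z(1)])
      have fin: "finite {e \<in> core f \<union> T \<union> {x}. z \<in> e}" by (rule finite_subset[OF le]) simp
      have "card {e \<in> core f \<union> T \<union> {x}. z \<in> e} \<le> card {t, x}" by (rule card_mono[OF _ le]) simp
      also have "\<dots> \<le> 2" by (simp add: card_insert_if)
      finally have "z \<notin> f2 ` V"
        using low_degree_core[OF f2(1) _ fin] f2(2) threats(2) by simp
      then show False using core_subset[OF t] z(1) by (meson subsetD)
    qed
  qed
  moreover have "card (insert x (core f)) \<le> Suc (card C)"
    using card_core[OF threats(1)] by (metis card_insert_le_m1 card_insert_if finite_core le_SucI order_refl)
  ultimately show ?thesis using finite_core by (intro exI[of _ "insert x (core f)"]) auto
next
  case (spoiled f z e)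
  let ?r = "insert z (f ` R)" and ?g = "insert z (f ` G)"
  have at_z: "{E \<in> insert x F. z \<in> E} \<subseteq> {?r, ?g, x}"
    using full_edges_at_apex[OF spoiled(2)] spoiled(3) by blast
  have fR: "z \<notin> f ` R" "z \<notin> f ` G" using spoiled(2) spot_images_subset by (meson subsetD)+
  have meet: "card (?r \<inter> ?g) = Suc (card (R \<inter> G))"
  proof -
    have "?r \<inter> ?g = insert z (f ` (R \<inter> G))"
      using inj_on_image_Int[OF spoiled(1) spots(1,2)] by blast
    moreover have "card (f ` (R \<inter> G)) = card (R \<inter> G)"
      using spoiled(1) spots(1) by (intro card_image inj_on_subset[OF spoiled(1)]) blast
    moreover have "finite (f ` (R \<inter> G))" "z \<notin> f ` (R \<inter> G)" using finite_spots fR by auto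
    ultimately show ?thesis by simp
  qed
  have "core f2 \<subseteq> insert x (core f)" if f2: "inj_on f2 V" "core f2 \<subseteq> insert x F" for f2
  proof -
    \<comment> \<open>A core vertex at \<open>z\<close> would use all of \<open>?r\<close>,
      \<open>?g\<close> and \<open>x\<close>, so it would have degree exactly 3 and lie on two edges
      meeting in \<open>Suc (card (R \<inter> G))\<close> vertices, against
      \<open>degree3_meet\<close>.\<close>
    have "z \<notin> f2 ` V"
    proof
      assume "z \<in> f2 ` V"
      then obtain u where u: "u \<in> V" "z = f2 u" by (rule imageE)
      have sub: "{E \<in> core f2. z \<in> E} \<subseteq> {?r, ?g, x}"
      proof (rule subset_trans[OF _ at_z])
        show "{E \<in> core f2. z \<in> E} \<subseteq> {E \<in> insert x F. z \<in> E}"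
          by (rule Collect_mono) (use f2(2) in \<open>meson subsetD\<close>)
      qed
      have "3 \<le> card {E \<in> core f2. z \<in> E}" by (rule degree_core_ge[OF f2(1) \<open>z \<in> f2 ` V\<close>])
      moreover have "card {?r, ?g, x} \<le> 3" by (simp add: card_insert_if)
      ultimately have eq: "{E \<in> core f2. z \<in> E} = {?r, ?g, x}"
        using card_seteq[OF _ sub] by simp
      have "card {E \<in> core f2. z \<in> E} = 3"
        using \<open>3 \<le> card {E \<in> core f2. z \<in> E}\<close> \<open>card {?r, ?g, x} \<le> 3\<close> eq by simp
      then have u3: "card {E \<in> C. u \<in> E} = 3" using degree_core[OF f2(1) u(1)] u(2) by simp
      have "?r \<in> {E \<in> core f2. z \<in> E}" "?g \<in> {E \<in> core f2. z \<in> E}" unfolding eq by blast+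
      then obtain a b where ab: "a \<in> C" "b \<in> C" "?r = f2 ` a" "?g = f2 ` b"
        by (auto simp: core_copy_def)
      have sub_V: "a \<subseteq> V" "b \<subseteq> V" using ab(1,2) by blast+
      have "f2 u \<in> f2 ` a" "f2 u \<in> f2 ` b" unfolding ab(3,4)[symmetric] u(2)[symmetric] by simp_all
      then have "u \<in> a" "u \<in> b"
        using inj_on_image_mem_iff[OF f2(1) u(1) sub_V(1)] inj_on_image_mem_iff[OF f2(1) u(1) sub_V(2)]
        by simp_all
      moreover have "a \<noteq> b" using ab link_edges(1)[OF spoiled(1,2)] by auto
      ultimately have "card (a \<inter> b) \<noteq> Suc (card (R \<inter> G))" using degree3_meet[OF u3 ab(1,2)] by blast
      moreover have "card (a \<inter> b) = card (f2 ` (a \<inter> b))"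
        by (rule card_image[symmetric], rule inj_on_subset[OF f2(1)]) (use sub_V in blast)
      moreover have "f2 ` (a \<inter> b) = ?r \<inter> ?g" using inj_on_image_Int[OF f2(1) sub_V] ab by simp
      ultimately show False using meet by simp
    qed
    then have "z \<notin> E" if "E \<in> core f2" for E using core_subset[OF that] by (meson subsetD)
    then have "?r \<notin> core f2" "?g \<notin> core f2" by blast+
    then show ?thesis using f2(2) spoiled(3) by (auto simp: full_copy_def)
  qed
  moreover have "card (insert x (core f)) \<le> Suc (card C)"
    using card_core[OF spoiled(1)] finite_core[of f] by (simp add: card_insert_if)
  ultimately show ?thesis using finite_core by (intro exI[of _ "insert x (core f)"]) auto
qed

section \<open>Choosing the spot of the forced answers\<close>

text \<open>\<open>A\<close> is the spot of the forced answers. The second condition ensures that such an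
  answer is not itself a threat: the edge completing it has been claimed by the drawing player.\<close>

definition orients :: "nat set \<Rightarrow> nat set \<Rightarrow> (nat \<Rightarrow> nat) \<Rightarrow> nat set set \<Rightarrow> bool" where
  "orients A B f F \<longleftrightarrow> (A = f ` R \<and> B = f ` G \<or> A = f ` G \<and> B = f ` R) \<and>
     (\<forall>f2. inj_on f2 V \<longrightarrow> core f2 \<subseteq> F \<longrightarrow>
        (A = f2 ` R \<longrightarrow> B = f2 ` G) \<and> (A = f2 ` G \<longrightarrow> B = f2 ` R))"

lemma not_orientsE:
  assumes "\<not> orients A B f F" "A = f ` R \<and> B = f ` G \<or> A = f ` G \<and> B = f ` R"
  obtains f2 where "inj_on f2 V" "core f2 \<subseteq> F" "A = f2 ` R \<and> B \<noteq> f2 ` G \<or> A = f2 ` G \<and> B \<noteq> f2 ` R"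
  using assms unfolding orients_def by metis

text \<open>If both choices failed, the opponent could have a core \<open>f2\<close> with spot
  \<open>f\<close> G\<open>and a core\<close>f3\<open>with spot\<close>f \<open>R\<close>, each with
  a wrong partner. They share all but one edge. Equal spots would make the partners right, and
  otherwise no spot of \<open>f2\<close> meets a spot of \<open>f3\<close> in
  \<open>card (R \<inter> G)\<close> vertices, although these two do.\<close>

lemma ex_orients:
  assumes "core_race F S" "finite F" "F \<inter> S = {}" "x \<notin> F \<union> S" and f: "inj_on f V"
  shows "\<exists>A B. orients A B f (insert x F)"
proof (rule ccontr)
  assume no: "\<nexists>A B. orients A B f (insert x F)"
  have "\<not> orients (f ` G) (f ` R) f (insert x F)" using no by blast
  then obtain f2 where f2: "inj_on f2 V" "core f2 \<subseteq> insert x F"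
    and bad2: "f ` G = f2 ` R \<and> f ` R \<noteq> f2 ` G \<or> f ` G = f2 ` G \<and> f ` R \<noteq> f2 ` R"
    by (rule not_orientsE) simp
  have "\<not> orients (f ` R) (f ` G) f (insert x F)" using no by blast
  then obtain f3 where f3: "inj_on f3 V" "core f3 \<subseteq> insert x F"
    and bad3: "f ` R = f3 ` R \<and> f ` G \<noteq> f3 ` G \<or> f ` R = f3 ` G \<and> f ` G \<noteq> f3 ` R"
    by (rule not_orientsE) simp
  obtain A where A: "finite A" "card A \<le> Suc (card C)"
    and "\<forall>f2. inj_on f2 V \<longrightarrow> core f2 \<subseteq> insert x F \<longrightarrow> core f2 \<subseteq> A"
    using core_race_cores[OF assms(1-4)] by (elim exE conjE)
  then have "core f2 \<subseteq> A" "core f3 \<subseteq> A" using f2 f3 by simp_all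
  then have "card (core f2 \<union> core f3) \<le> Suc (card C)"
    using A card_mono[of A "core f2 \<union> core f3"] by simp
  then have "card C \<le> Suc (card (core f2 \<inter> core f3))"
    using card_Un_Int[OF finite_core finite_core, of f2 f3] card_core f2(1) f3(1) by simp
  from almost_rigid[OF f2(1) f3(1) this] show False
  proof
    assume "f2 ` R = f3 ` R \<and> f2 ` G = f3 ` G"
    then show False using bad2 bad3 spot_images_neq[OF f] by metis
  next
    have "f ` R \<inter> f ` G = f ` (R \<inter> G)" using inj_on_image_Int[OF f spots(1,2)] by simp
    moreover have "card (f ` (R \<inter> G)) = card (R \<inter> G)"
      by (rule card_image, rule inj_on_subset[OF f]) (use spots(1) in blast)
    ultimately have "card (f ` R \<inter> f ` G) = card (R \<inter> G)" "card (f ` G \<inter> f ` R) = card (R \<inter> G)"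
      by (simp_all add: Int_commute)
    moreover assume "card (R \<inter> G) \<notin> {card (f2 ` R \<inter> f3 ` R), card (f2 ` R \<inter> f3 ` G),
        card (f2 ` G \<inter> f3 ` R), card (f2 ` G \<inter> f3 ` G)}"
    ultimately show False using bad2 bad3 by - (elim disjE conjE; simp)
  qed
qed

section \<open>Perpetual threats\<close>

text \<open>A complete copy inside \<open>F\<close> is excluded as well, as long as some edge is
  free: every free \<open>y\<close> would then satisfy the premises.\<close>

definition no_threat :: "nat set set \<Rightarrow> nat set set \<Rightarrow> bool" where
  "no_threat F S \<longleftrightarrow> (\<forall>f z y. inj_on f V \<longrightarrow> z \<notin> f ` V \<longrightarrow> full f z \<subseteq> insert y F \<longrightarrow> y \<in> F \<union> S)"

lemma no_threatD:
  assumes "no_threat F S" "inj_on f V" "z \<notin> f ` V" "full f z \<subseteq> insert y F"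
  shows "y \<in> F \<union> S"
  using assms(1)[unfolded no_threat_def, rule_format, OF assms(2-4)] .

lemma no_threat_mono: "no_threat F S \<Longrightarrow> S \<subseteq> S' \<Longrightarrow> no_threat F S'"
  unfolding no_threat_def by (meson Un_mono order_refl subsetD)

text \<open>\<open>F0\<close> are the opponent's edges at the start of the perpetual threats, \<open>Z\<close> the fresh vertices used
  so far and \<open>z\<close> the vertex of the pending threat.\<close>

definition perpetual :: "(nat \<Rightarrow> nat) \<Rightarrow> nat set \<Rightarrow> nat set \<Rightarrow> nat set set \<Rightarrow> nat set \<Rightarrow> nat \<Rightarrow>
    nat set set \<Rightarrow> nat set set \<Rightarrow> bool" where
  "perpetual f A B F0 Z z F S \<longleftrightarrow>
     inj_on f V \<and> core f \<subseteq> S \<and> orients A B f F0 \<and> no_threat F0 S \<and>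
     F = F0 \<union> (\<lambda>w. insert w A) ` Z \<and>
     (\<forall>w\<in>insert z Z. w \<notin> f ` V \<and> w \<notin> \<Union>F0 \<and> insert w B \<in> S) \<and>
     z \<notin> Z \<and> insert z A \<notin> S"

lemma orients_subset:
  assumes "orients A B f F"
  shows "A \<subseteq> f ` V" "B \<subseteq> f ` V"
  using assms spot_images_subset[of f] unfolding orients_def by metis+

text \<open>A vertex of \<open>Z\<close> lies only on its answer and possibly on \<open>x\<close>,
  so an answer used in a copy sits at the apex and \<open>x\<close> is the other link edge. By
  \<open>orients\<close> this is \<open>insert z2 B\<close>, which \<open>S\<close> owns. A copy
  without answers would be a threat in \<open>F0\<close>.\<close>

lemma perpetual_no_copy:
  assumes p: "perpetual f A B F0 Z z F S" and x: "x \<notin> F \<union> S"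
    and f2: "inj_on f2 V" "z2 \<notin> f2 ` V" "full f2 z2 \<subseteq> insert x F"
  shows False
proof -
  have F: "F = F0 \<union> (\<lambda>w. insert w A) ` Z" and or: "orients A B f F0" and nt: "no_threat F0 S"
    using p unfolding perpetual_def by simp_all
  have "\<forall>w\<in>insert z Z. w \<notin> f ` V \<and> w \<notin> \<Union>F0 \<and> insert w B \<in> S"
    using p unfolding perpetual_def by (elim conjE)
  then have Z: "w \<notin> f ` V \<and> w \<notin> \<Union>F0 \<and> insert w B \<in> S" if "w \<in> Z" for w
    by (rule bspec) (simp add: that)
  have notA: "w \<notin> A" if "w \<in> Z" for w using Z[OF that] orients_subset(1)[OF or] by (meson subsetD)
  have at: "{e \<in> insert x F. w \<in> e} \<subseteq> {insert w A, x}" if "w \<in> Z" for w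
    using notA[OF that] Z[OF that] unfolding F by blast
  have apex: "w = z2" if w: "w \<in> Z" "insert w A \<in> full f2 z2" for w
  proof (rule low_degree_apex[OF f2 _ _ w(2)])
    show "finite {e \<in> insert x F. w \<in> e}" by (rule finite_subset[OF at[OF w(1)]]) simp
    have "card {e \<in> insert x F. w \<in> e} \<le> card {insert w A, x}"
      by (rule card_mono[OF _ at[OF w(1)]]) simp
    then show "card {e \<in> insert x F. w \<in> e} \<le> 3" by (simp add: card_insert_if split: if_splits)
  qed simp
  show False
  proof (cases "\<exists>w\<in>Z. insert w A \<in> full f2 z2")
    case False
    then have "full f2 z2 \<subseteq> insert x F0" using f2(3) unfolding F by blast
    then have "x \<in> F0 \<union> S" by (rule no_threatD[OF nt f2(1,2)])
    then show False using x F by blast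
  next
    case True
    then obtain w where "w \<in> Z" "insert w A \<in> full f2 z2" by (elim bexE)
    then have z2: "z2 \<in> Z" using apex[of w] by simp
    let ?r = "insert z2 (f2 ` R)" and ?g = "insert z2 (f2 ` G)"
    have "{e \<in> full f2 z2. z2 \<in> e} \<subseteq> {e \<in> insert x F. z2 \<in> e}"
      by (rule Collect_mono) (use f2(3) in \<open>meson subsetD\<close>)
    then have "{?r, ?g} \<subseteq> {insert z2 A, x}"
      using at[OF z2] unfolding full_edges_at_apex[OF f2(2)] by (rule subset_trans)
    then have rg: "?r = insert z2 A \<and> ?g = x \<or> ?r = x \<and> ?g = insert z2 A"
      using link_edges(1)[OF f2(1,2)] by auto
    \<comment> \<open>Core edges avoid \<open>z2\<close>, whereas \<open>x\<close> and every answer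
      used in the copy contain it.\<close>
    have "core f2 \<subseteq> F0"
    proof
      fix e assume e: "e \<in> core f2"
      have ze: "z2 \<notin> e" using core_subset[OF e] f2(2) by (meson subsetD)
      have "e \<noteq> x" using ze rg by blast
      moreover have "e \<noteq> insert w A" if "w \<in> Z" for w
      proof
        assume "e = insert w A"
        then have "w = z2" using apex[OF that] e core_subset_full[of f2 z2] by (metis subsetD)
        then show False using ze \<open>e = insert w A\<close> by blast
      qed
      moreover have "e \<in> insert x F" using e core_subset_full[of f2 z2] f2(3) by (meson subsetD)
      ultimately show "e \<in> F0" unfolding F by blast
    qed
    then have two: "A = f2 ` R \<longrightarrow> B = f2 ` G" "A = f2 ` G \<longrightarrow> B = f2 ` R"
      using or[unfolded orients_def, THEN conjunct2, rule_format, OF f2(1)] by simp_all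
    have "z2 \<notin> f2 ` R" "z2 \<notin> f2 ` G" using f2(2) spot_images_subset by (meson subsetD)+
    then have "A = f2 ` R \<and> x = insert z2 (f2 ` G) \<or> A = f2 ` G \<and> x = insert z2 (f2 ` R)"
      using rg notA[OF z2] insert_ident by metis
    then have "x = insert z2 B" using two by metis
    then show False using x Z[OF z2] by simp
  qed
qed

lemma spot_edge_board:
  assumes "inj_on f V" "orients A B f F" "w \<notin> f ` V"
  shows "insert w A \<in> board_edges k" "insert w B \<in> board_edges k"
proof -
  have "insert w (f ` R) \<in> board_edges k" "insert w (f ` G) \<in> board_edges k"
    using full_board[OF assms(1,3)] by (auto simp: full_copy_def)
  then show "insert w A \<in> board_edges k" "insert w B \<in> board_edges k"
    using assms(2) unfolding orients_def by metis+
qed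

lemma finite_Union_board: "finite X \<Longrightarrow> X \<subseteq> board_edges k \<Longrightarrow> finite (\<Union>X)"
  by (auto simp: board_edges_def)

lemma ex_fresh: "finite (X :: nat set) \<Longrightarrow> \<exists>w. w \<notin> X"
  using ex_new_if_finite infinite_UNIV_nat by blast

text \<open>A pending edge left open completes a copy; if it is taken, a vertex \<open>w\<close>
  outside all claimed edges makes the next pair of edges free.\<close>

lemma perpetual_step:
  assumes p: "perpetual f A B F0 Z z F S" and x: "x \<in> board_edges k"
    and fin: "finite F" "finite S" "F \<union> S \<subseteq> board_edges k"
  shows "\<exists>y\<in>board_edges k. y \<notin> insert x (F \<union> S) \<and>
    (contains_copy (insert y S) target \<or>
     (\<exists>z'. perpetual f A B F0 (insert z Z) z' (insert x F) (insert y S)))"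
proof -
  have f: "inj_on f V" "core f \<subseteq> S" and F: "F = F0 \<union> (\<lambda>w. insert w A) ` Z"
    and or: "orients A B f F0" and nt: "no_threat F0 S"
    and z: "z \<notin> Z" "insert z A \<notin> S"
    using p unfolding perpetual_def by simp_all
  have Z_all: "\<forall>w\<in>insert z Z. w \<notin> f ` V \<and> w \<notin> \<Union>F0 \<and> insert w B \<in> S"
    using p unfolding perpetual_def by (elim conjE)
  then have Z: "w \<notin> f ` V \<and> w \<notin> \<Union>F0 \<and> insert w B \<in> S" if "w \<in> insert z Z" for w
    using that by (rule bspec)
  have zV: "z \<notin> f ` V" using Z by simp
  then have zA: "z \<notin> A" using orients_subset(1)[OF or] by (meson subsetD)
  have zF: "z \<notin> \<Union>F" using Z[of z] z(1) zA unfolding F by auto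
  have AB: "A \<noteq> B" using or spot_images_neq[OF f(1)] unfolding orients_def by metis
  show ?thesis
  proof (cases "x = insert z A")
    case False
    let ?y = "insert z A"
    have "full f z \<subseteq> insert ?y S"
      using f(2) Z[of z] or unfolding orients_def full_copy_def by auto
    then have "contains_copy (insert ?y S) target"
      using f(1) zV unfolding contains_target_iff by (intro exI conjI)
    moreover have "?y \<notin> insert x (F \<union> S)" using False zF z(2) by auto
    ultimately show ?thesis using spot_edge_board(1)[OF f(1) or zV] by (intro bexI[of _ ?y]) simp_all
  next
    case True
    have "finite (\<Union>(insert x (F \<union> S)) \<union> f ` V)"
      using fin x finite_V by (intro finite_UnI finite_Union_board) auto
    from ex_fresh[OF this] obtain w where w: "w \<notin> \<Union>(insert x (F \<union> S)) \<union> f ` V" by (rule exE)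
    let ?y = "insert w B"
    have "w \<notin> insert z Z"
    proof
      assume "w \<in> insert z Z"
      then have "w \<in> \<Union>(insert x (F \<union> S))" using True unfolding F by auto
      then show False using w by simp
    qed
    moreover have "w \<notin> \<Union>F0" using w unfolding F by auto
    moreover have "insert w A \<noteq> ?y"
    proof -
      have "w \<notin> A" "w \<notin> B" using w orients_subset[OF or] by (meson UnI2 subsetD)+
      then show ?thesis using AB insert_ident by metis
    qed
    moreover have "insert w A \<notin> S" using w by auto
    moreover have "insert x F = F0 \<union> (\<lambda>w. insert w A) ` insert z Z" unfolding F True by simp
    moreover have "\<forall>u\<in>insert w (insert z Z). u \<notin> f ` V \<and> u \<notin> \<Union>F0 \<and> insert u B \<in> insert ?y S"
      using Z_all w \<open>w \<notin> \<Union>F0\<close> by simp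
    moreover have "no_threat F0 (insert ?y S)" by (rule no_threat_mono[OF nt]) auto
    moreover have "core f \<subseteq> insert ?y S" using f(2) by (rule subset_insertI2)
    ultimately have "perpetual f A B F0 (insert z Z) w (insert x F) (insert ?y S)"
      using f(1) or unfolding perpetual_def by simp
    moreover have "?y \<notin> insert x (F \<union> S)" using w by auto
    moreover have "?y \<in> board_edges k" using spot_edge_board(2)[OF f(1) or] w by simp
    ultimately show ?thesis by (intro bexI[of _ ?y] conjI disjI2 exI[of _ w])
  qed
qed

text \<open>The orientation is fixed here once and for all, against the cores available in
  \<open>insert x F\<close>; every later edge of the opponent is a forced answer unless he lets a
  copy be completed.\<close>

lemma perpetual_start:
  assumes "core_race F S" and f: "inj_on f V" "core f \<subseteq> S"
    and fin: "finite F" "finite S" "F \<union> S \<subseteq> board_edges k" "F \<inter> S = {}"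
    and x: "x \<in> board_edges k" "x \<notin> F \<union> S" and nt: "no_threat (insert x F) S"
  shows "\<exists>y\<in>board_edges k. y \<notin> insert x (F \<union> S) \<and>
    (\<exists>A B z'. perpetual f A B (insert x F) {} z' (insert x F) (insert y S))"
proof -
  obtain A B where or: "orients A B f (insert x F)"
    using ex_orients[OF assms(1) fin(1,4) x(2) f(1)] by (elim exE)
  have "finite (\<Union>(insert x (F \<union> S)) \<union> f ` V)"
    using fin x finite_V by (intro finite_UnI finite_Union_board) auto
  from ex_fresh[OF this] obtain w where w: "w \<notin> \<Union>(insert x (F \<union> S)) \<union> f ` V" by (rule exE)
  let ?y = "insert w B"
  have AB: "A \<noteq> B" using or spot_images_neq[OF f(1)] unfolding orients_def by metis
  have "w \<notin> A" "w \<notin> B" using w orients_subset[OF or] by (meson UnI2 subsetD)+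
  then have "insert w A \<noteq> ?y" using AB insert_ident by metis
  moreover have "insert w A \<notin> S" using w by auto
  moreover have "no_threat (insert x F) (insert ?y S)" by (rule no_threat_mono[OF nt]) auto
  moreover have "core f \<subseteq> insert ?y S" using f(2) by (rule subset_insertI2)
  moreover have "w \<notin> f ` V" "w \<notin> \<Union>(insert x F)" using w by simp_all
  ultimately have "perpetual f A B (insert x F) {} w (insert x F) (insert ?y S)"
    using f(1) or unfolding perpetual_def by simp
  moreover have "?y \<notin> insert x (F \<union> S)" using w by auto
  moreover have "?y \<in> board_edges k" using spot_edge_board(2)[OF f(1) or] w by simp
  ultimately show ?thesis by (intro bexI[of _ ?y] conjI exI)
qed

section \<open>The opening: a core without a wasted move\<close>

text \<open>Only the edges of \<open>F\<close> are counted, as the measure of time. \<open>S\<close>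
  may hold further edges, since a drawing player who starts has an idle one.\<close>

definition opening_path :: "nat set set \<Rightarrow> nat set set \<Rightarrow> bool" where
  "opening_path F S \<longleftrightarrow> (\<exists>j f. j < length es \<and> card F = j \<and>
     inj_on f (\<Union>(set (take j es))) \<and> (\<forall>e\<in>set (take j es). f ` e \<in> S))"

text \<open>All four closers contain \<open>v\<close> and differ from \<open>last es\<close>, so the
  last condition says that their images are free.\<close>

definition opening_closers :: "nat set set \<Rightarrow> nat set set \<Rightarrow> bool" where
  "opening_closers F S \<longleftrightarrow> (\<exists>f. inj_on f V \<and> card F = length es \<and> (\<forall>e\<in>set es. f ` e \<in> S) \<and>
     (\<forall>e\<in>F \<union> S. f v \<in> e \<longrightarrow> e = f ` last es))"

definition opening_last :: "nat set set \<Rightarrow> nat set set \<Rightarrow> bool" where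
  "opening_last F S \<longleftrightarrow> (\<exists>f. inj_on f V \<and> card F = Suc (length es) \<and> (\<forall>e\<in>set es. f ` e \<in> S) \<and>
     ((\<exists>a\<in>{s1, s1'}. f ` a \<in> S \<and> f ` s2 \<notin> F \<union> S \<and> f ` s2' \<notin> F \<union> S) \<or>
      (\<exists>b\<in>{s2, s2'}. f ` b \<in> S \<and> f ` s1 \<notin> F \<union> S \<and> f ` s1' \<notin> F \<union> S)))"

lemma image_board:
  assumes "inj_on f e" "finite e" "card e = k"
  shows "f ` e \<in> board_edges k"
  using assms by (simp add: board_edges_def card_image)

text \<open>The alternatives need not be edges of \<open>C\<close>; they inherit their size from
  \<open>s1\<close> and \<open>s2\<close> through \<open>closers_symmetric\<close>.\<close>

lemma closer_card:
  assumes "s \<in> {s1, s1', s2, s2'}"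
  shows "s \<subseteq> V" "finite s" "card s = k"
proof -
  show "s \<subseteq> V" unfolding V_eq using assms closers(6) by auto
  then show "finite s" using finite_V finite_subset by auto
  obtain a b where ab: "a \<in> {s1, s1'}" "b \<in> {s2, s2'}" "s = a \<or> s = b" using assms by auto
  obtain \<rho> where \<rho>: "inj_on \<rho> V" "\<rho> ` s1 = a" "\<rho> ` s2 = b"
    using closers_symmetric[OF ab(1,2)] by (elim exE conjE)
  have C: "s1 \<in> C" "s2 \<in> C" by (simp_all add: C_eq)
  then have "inj_on \<rho> s1" "inj_on \<rho> s2" using \<rho>(1) by (meson Union_upper inj_on_subset)+
  then show "card s = k" using ab(3) \<rho>(2,3) card_edge C card_image by metis
qed

lemma closer_image_board:
  assumes "inj_on f V" "s \<in> {s1, s1', s2, s2'}"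
  shows "f ` s \<in> board_edges k"
  using closer_card[OF assms(2)] inj_on_subset[OF assms(1)] by (intro image_board)

lemma closer_image_eq:
  assumes "inj_on f V" "s \<in> {s1, s1', s2, s2'}" "t \<in> {s1, s1', s2, s2'}"
  shows "f ` s = f ` t \<longleftrightarrow> s = t"
  using closer_card(1) assms inj_on_image_eq_iff by metis

lemma ex_closer_image_neq:
  assumes "inj_on f V"
  shows "\<exists>a\<in>{s1, s1'}. x \<noteq> f ` a" "\<exists>b\<in>{s2, s2'}. x \<noteq> f ` b"
  using closer_image_eq[OF assms, of s1 s1'] closer_image_eq[OF assms, of s2 s2'] closers(1,2)
  by simp_all

lemma opening_path_step:
  assumes o: "opening_path F S" and x: "x \<notin> F" "x \<in> board_edges k"
    and fin: "finite F" "finite S" "F \<union> S \<subseteq> board_edges k"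
  shows "\<exists>y\<in>board_edges k. y \<notin> insert x (F \<union> S) \<and>
    (opening_path (insert x F) (insert y S) \<or> opening_closers (insert x F) (insert y S))"
proof -
  obtain j f where j: "j < length es" "card F = j" and f: "inj_on f (\<Union>(set (take j es)))"
    "\<forall>e\<in>set (take j es). f ` e \<in> S"
    using o unfolding opening_path_def by (elim exE conjE)
  define U where "U = \<Union>(set (take j es))"
  define e where "e = es ! j"
  define X where "X = \<Union>(insert x (F \<union> S))"
  have U_V: "U \<subseteq> V" unfolding U_def V_eq using set_take_subset[of j es] by blast
  then have finU: "finite U" using finite_V finite_subset by auto
  have finX: "finite X"
    unfolding X_def using fin x by (intro finite_Union_board) auto
  have eC: "e \<in> C" using j(1) by (simp add: C_eq e_def)
  obtain g where g: "inj_on g (U \<union> e)" "\<forall>u\<in>U. g u = f u" "\<forall>w\<in>e - U. g w \<notin> X"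
    using inj_on_extend_fresh[OF f(1)[folded U_def] finU finX, of e] by (elim exE conjE)
  let ?y = "g ` e"
  have y: "?y \<in> board_edges k"
    using inj_on_subset[OF g(1)] card_edge[OF eC] finite_edge[OF eC] by (intro image_board) auto
  \<comment> \<open>No claimed edge contains the image of this new vertex, so the opponent cannot
    have blocked the edge in advance.\<close>
  obtain w where w: "w \<in> e" "w \<notin> U" using es_fresh[OF j(1)] unfolding e_def U_def by (meson subsetI)
  then have "g w \<notin> X" using g(3) by simp
  then have free: "?y \<notin> insert x (F \<union> S)" using w(1) unfolding X_def by auto
  have take_Suc: "take (Suc j) es = take j es @ [e]"
    using j(1) by (simp add: take_Suc_conv_app_nth e_def)
  have inj: "inj_on g (\<Union>(set (take (Suc j) es)))"
    using g(1) by (simp add: take_Suc U_def Un_commute)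
  have "g ` e' = f ` e'" if "e' \<in> set (take j es)" for e'
    using that g(2) unfolding U_def by (intro image_cong refl) blast
  then have claimed: "\<forall>e'\<in>set (take (Suc j) es). g ` e' \<in> insert ?y S"
    using f(2) by (simp add: take_Suc)
  have card: "card (insert x F) = Suc j" using j(2) fin(1) x(1) by simp
  have "opening_path (insert x F) (insert ?y S) \<or> opening_closers (insert x F) (insert ?y S)"
  proof (cases "Suc j < length es")
    case True
    then have "opening_path (insert x F) (insert ?y S)"
      unfolding opening_path_def using card inj claimed by (intro exI[of _ "Suc j"] exI[of _ g] conjI)
    then show ?thesis by simp
  next
    case False
    then have len: "length es = Suc j" using j(1) by simp
    have last: "last es = e" using len v_fresh(1) by (simp add: last_conv_nth e_def)
    have "butlast es = take j es" using len by (simp add: butlast_conv_take)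
    \<comment> \<open>\<open>v\<close> first occurs in the last path edge, so its image is fresh too
      and the closers through it are still free.\<close>
    then have "v \<in> e - U" using v_fresh(2,3) last unfolding U_def by simp
    then have "g v \<notin> X" using g(3) by simp
    then have "\<forall>e'\<in>insert x F \<union> insert ?y S. g v \<in> e' \<longrightarrow> e' = g ` last es"
      unfolding X_def last by auto
    moreover have "inj_on g V" using inj unfolding V_eq by (simp add: len[symmetric])
    moreover have "\<forall>e'\<in>set es. g ` e' \<in> insert ?y S" using claimed by (simp add: len[symmetric])
    ultimately have "opening_closers (insert x F) (insert ?y S)"
      unfolding opening_closers_def using card len by (intro exI[of _ g] conjI) simp_all
    then show ?thesis by simp
  qed
  then show ?thesis using y free by (intro bexI[of _ ?y]) simp_all
qed

text \<open>Pairing: the reply takes a free edge of the second pair if that pair was attacked and of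
  the first pair otherwise, so the other pair stays untouched.\<close>

lemma opening_closers_step:
  assumes o: "opening_closers F S" and x: "x \<notin> F" and fin: "finite F"
  shows "\<exists>y\<in>board_edges k. y \<notin> insert x (F \<union> S) \<and> opening_last (insert x F) (insert y S)"
proof -
  obtain f where f: "inj_on f V" "card F = length es" "\<forall>e\<in>set es. f ` e \<in> S"
    "\<forall>e\<in>F \<union> S. f v \<in> e \<longrightarrow> e = f ` last es"
    using o unfolding opening_closers_def by (elim exE conjE)
  have free: "f ` s \<notin> F \<union> S" if s: "s \<in> {s1, s1', s2, s2'}" for s
  proof
    assume "f ` s \<in> F \<union> S"
    moreover have "f v \<in> f ` s" using s closers(5) by auto
    ultimately have "f ` s = f ` last es" using f(4) by blast
    moreover have "last es \<subseteq> V" unfolding V_eq using v_fresh(1) last_in_set by blast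
    ultimately have "s = last es" using inj_on_image_eq_iff[OF f(1) closer_card(1)[OF s]] by simp
    then show False using s closers(4) by simp
  qed
  have neq: "f ` s \<noteq> f ` t" if "s \<in> {s1, s1', s2, s2'}" "t \<in> {s1, s1', s2, s2'}" "s \<noteq> t" for s t
    using closer_image_eq[OF f(1) that(1,2)] that(3) by simp
  have card: "card (insert x F) = Suc (length es)" using f(2) fin x by simp
  have claimed: "\<forall>e\<in>set es. f ` e \<in> insert y S" for y using f(3) by simp
  have "s1 \<noteq> s2" "s1 \<noteq> s2'" "s1' \<noteq> s2" "s1' \<noteq> s2'" using closers(3) by auto
  then have images_neq: "f ` s1 \<noteq> f ` s2" "f ` s1 \<noteq> f ` s2'" "f ` s1' \<noteq> f ` s2" "f ` s1' \<noteq> f ` s2'"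
    using neq by simp_all
  have images_free: "f ` s1 \<notin> F \<union> S" "f ` s1' \<notin> F \<union> S" "f ` s2 \<notin> F \<union> S" "f ` s2' \<notin> F \<union> S"
    using free by simp_all
  show ?thesis
  proof (cases "x = f ` s2 \<or> x = f ` s2'")
    case True
    obtain b where b: "b \<in> {s2, s2'}" "x \<noteq> f ` b"
      using ex_closer_image_neq(2)[OF f(1), where x = x] by (elim bexE)
    have "f ` s1 \<notin> insert x F \<union> insert (f ` b) S" "f ` s1' \<notin> insert x F \<union> insert (f ` b) S"
      using True b(1) images_free images_neq by - (elim insertE disjE emptyE; simp)+
    then have "opening_last (insert x F) (insert (f ` b) S)"
      unfolding opening_last_def using f(1) card claimed b(1)
      by (intro exI[of _ f] conjI disjI2 bexI[of _ b]) simp_all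
    moreover have "f ` b \<in> board_edges k" using b(1) by (intro closer_image_board[OF f(1)]) auto
    moreover have "f ` b \<notin> insert x (F \<union> S)" using b free[of b] by (elim insertE emptyE) simp_all
    ultimately show ?thesis by (intro bexI[of _ "f ` b"] conjI)
  next
    case False
    then have x_neq: "f ` s2 \<noteq> x" "f ` s2' \<noteq> x" by metis+
    obtain a where a: "a \<in> {s1, s1'}" "x \<noteq> f ` a"
      using ex_closer_image_neq(1)[OF f(1), where x = x] by (elim bexE)
    have "f ` s2 \<notin> insert x F \<union> insert (f ` a) S" "f ` s2' \<notin> insert x F \<union> insert (f ` a) S"
      using a(1) images_free images_neq[symmetric] x_neq by - (elim insertE emptyE; simp)+
    then have "opening_last (insert x F) (insert (f ` a) S)"
      unfolding opening_last_def using f(1) card claimed a(1)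
      by (intro exI[of _ f] conjI disjI1 bexI[of _ a]) simp_all
    moreover have "f ` a \<in> board_edges k" using a(1) by (intro closer_image_board[OF f(1)]) auto
    moreover have "f ` a \<notin> insert x (F \<union> S)" using a free[of a] by (elim insertE emptyE) simp_all
    ultimately show ?thesis by (intro bexI[of _ "f ` a"] conjI)
  qed
qed

text \<open>Whichever closers were obtained, \<open>\<rho>\<close> moves \<open>s1\<close> and
  \<open>s2\<close> to them and fixes the path, so \<open>f \<circ> \<rho>\<close> embeds the core.
  The opponent then owns \<open>length es + 2 = card C\<close> edges, the balanced start of the
  race.\<close>

lemma opening_last_step:
  assumes o: "opening_last F S" and x: "x \<notin> F" and fin: "finite F"
  shows "\<exists>y\<in>board_edges k. y \<notin> insert x (F \<union> S) \<and>
    (\<exists>f. inj_on f V \<and> core f \<subseteq> insert y S) \<and> core_race (insert x F) (insert y S)"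
proof -
  obtain f where f: "inj_on f V" "card F = Suc (length es)" "\<forall>e\<in>set es. f ` e \<in> S"
    and open_pair: "(\<exists>a\<in>{s1, s1'}. f ` a \<in> S \<and> f ` s2 \<notin> F \<union> S \<and> f ` s2' \<notin> F \<union> S) \<or>
      (\<exists>b\<in>{s2, s2'}. f ` b \<in> S \<and> f ` s1 \<notin> F \<union> S \<and> f ` s1' \<notin> F \<union> S)"
    using o unfolding opening_last_def by (elim exE conjE)
  have "\<exists>a\<in>{s1, s1'}. \<exists>b\<in>{s2, s2'}. \<exists>y\<in>{f ` a, f ` b}. y \<notin> insert x (F \<union> S) \<and>
      f ` a \<in> insert y S \<and> f ` b \<in> insert y S"
    using open_pair
  proof
    assume "\<exists>a\<in>{s1, s1'}. f ` a \<in> S \<and> f ` s2 \<notin> F \<union> S \<and> f ` s2' \<notin> F \<union> S"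
    then obtain a where a: "a \<in> {s1, s1'}" "f ` a \<in> S" "f ` s2 \<notin> F \<union> S" "f ` s2' \<notin> F \<union> S"
      by (elim bexE conjE)
    obtain b where b: "b \<in> {s2, s2'}" "x \<noteq> f ` b"
      using ex_closer_image_neq(2)[OF f(1), where x = x] by (elim bexE)
    have "f ` b \<notin> F \<union> S" using a(3,4) b(1) by - (elim insertE emptyE; simp)+
    then show ?thesis
      using a(1,2) b by (intro bexI[of _ a] bexI[of _ b] bexI[of _ "f ` b"]) simp_all
  next
    assume "\<exists>b\<in>{s2, s2'}. f ` b \<in> S \<and> f ` s1 \<notin> F \<union> S \<and> f ` s1' \<notin> F \<union> S"
    then obtain b where b: "b \<in> {s2, s2'}" "f ` b \<in> S" "f ` s1 \<notin> F \<union> S" "f ` s1' \<notin> F \<union> S"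
      by (elim bexE conjE)
    obtain a where a: "a \<in> {s1, s1'}" "x \<noteq> f ` a"
      using ex_closer_image_neq(1)[OF f(1), where x = x] by (elim bexE)
    have "f ` a \<notin> F \<union> S" using b(3,4) a(1) by - (elim insertE emptyE; simp)+
    then show ?thesis
      using b(1,2) a by (intro bexI[of _ a] bexI[of _ b] bexI[of _ "f ` a"]) simp_all
  qed
  then obtain a b y where ab: "a \<in> {s1, s1'}" "b \<in> {s2, s2'}" and y: "y \<in> {f ` a, f ` b}"
    "y \<notin> insert x (F \<union> S)" "f ` a \<in> insert y S" "f ` b \<in> insert y S"
    by (elim bexE conjE)
  obtain \<rho> where \<rho>: "inj_on \<rho> V" "\<rho> ` V \<subseteq> V" "\<forall>e\<in>set es. \<rho> ` e = e" "\<rho> ` s1 = a" "\<rho> ` s2 = b"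
    using closers_symmetric[OF ab] by (elim exE conjE)
  have "inj_on (f \<circ> \<rho>) V" using \<rho>(1) inj_on_subset[OF f(1) \<rho>(2)] by (rule comp_inj_on)
  moreover have "core (f \<circ> \<rho>) \<subseteq> insert y S"
  proof
    fix e assume "e \<in> core (f \<circ> \<rho>)"
    then obtain c where c: "c \<in> C" "e = (f \<circ> \<rho>) ` c" unfolding core_copy_def by (elim imageE)
    have e: "e = f ` \<rho> ` c" unfolding c(2) by (rule image_comp[symmetric])
    from c(1) consider "c = s1" | "c = s2" | "c \<in> set es" unfolding C_eq by auto
    then show "e \<in> insert y S" by cases (use e \<rho>(3-5) f(3) y(3,4) in simp_all)
  qed
  moreover have "core_race (insert x F) (insert y S)"
    unfolding core_race_def using f(2) fin x card_C by simp
  moreover have "y \<in> board_edges k" using y(1) ab by (auto intro!: closer_image_board[OF f(1)])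
  ultimately show ?thesis using y(2) by (intro bexI[of _ y] conjI exI[of _ "f \<circ> \<rho>"])
qed

section \<open>The complete invariant and the draw\<close>

text \<open>The first disjunct absorbs positions that the drawing player has won, from which
  \<open>drawing_invariant\<close> demands nothing more.\<close>

definition drawn :: "nat set set \<Rightarrow> nat set set \<Rightarrow> bool" where
  "drawn F S \<longleftrightarrow> finite F \<and> finite S \<and> F \<union> S \<subseteq> board_edges k \<and> F \<inter> S = {} \<and>
     (contains_copy S target \<or> opening_path F S \<or> opening_closers F S \<or> opening_last F S \<or>
      (\<exists>f. inj_on f V \<and> core f \<subseteq> S) \<and> core_race F S \<or>
      (\<exists>f A B F0 Z z. perpetual f A B F0 Z z F S))"

lemma card_opening_less:
  assumes "opening_path F S \<or> opening_closers F S \<or> opening_last F S"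
  shows "card F < card C"
  using assms card_C unfolding opening_path_def opening_closers_def opening_last_def by auto

lemma not_contains_target_small:
  assumes "finite F" "card F < card C"
  shows "\<not> contains_copy (insert x F) target"
proof
  assume "contains_copy (insert x F) target"
  then obtain f z where f: "inj_on f V" "z \<notin> f ` V" "full f z \<subseteq> insert x F"
    unfolding contains_target_iff by (elim exE conjE)
  have "card (full f z) \<le> card (insert x F)" using f(3) assms(1) by (intro card_mono) simp_all
  then show False using card_full[OF f(1,2)] assms by (simp add: card_insert_if split: if_splits)
qed

text \<open>A threat dictates the reply \<open>y\<close> and the race goes on; the first time there
  is none, the free move starts the perpetual threats.\<close>

lemma core_race_move:
  assumes f: "inj_on f V" "core f \<subseteq> S" and race: "core_race F S"
    and fin: "finite F" "finite S" "F \<union> S \<subseteq> board_edges k" "F \<inter> S = {}"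
    and x: "x \<in> board_edges k" "x \<notin> F \<union> S"
  shows "\<not> contains_copy (insert x F) target \<and> (\<exists>y\<in>board_edges k. y \<notin> insert x (F \<union> S) \<and>
    (core f \<subseteq> insert y S \<and> core_race (insert x F) (insert y S) \<or>
     (\<exists>f A B F0 Z z. perpetual f A B F0 Z z (insert x F) (insert y S))))"
proof
  show "\<not> contains_copy (insert x F) target"
  proof
    assume "contains_copy (insert x F) target"
    then obtain f2 z2 where f2: "inj_on f2 V" "z2 \<notin> f2 ` V" "full f2 z2 \<subseteq> insert x F"
      unfolding contains_target_iff by (elim exE conjE)
    \<comment> \<open>A complete copy is treated as a threat with completing edge
      \<open>y = x\<close>; the conclusion that \<open>y\<close> is new is then absurd.\<close>
    have "x \<notin> insert x F"
      using core_race_step[OF race fin(1,4) x(2) _ f2(1,2), of x] x(2) f2(3) by simp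
    then show False by simp
  qed
  show "\<exists>y\<in>board_edges k. y \<notin> insert x (F \<union> S) \<and>
    (core f \<subseteq> insert y S \<and> core_race (insert x F) (insert y S) \<or>
     (\<exists>f A B F0 Z z. perpetual f A B F0 Z z (insert x F) (insert y S)))"
  proof (cases "no_threat (insert x F) S")
    case True
    obtain y A B z' where "y \<in> board_edges k" "y \<notin> insert x (F \<union> S)"
      and p: "perpetual f A B (insert x F) {} z' (insert x F) (insert y S)"
      using perpetual_start[OF race f fin x True] by (elim bexE exE conjE)
    moreover have "\<exists>f A B F0 Z z. perpetual f A B F0 Z z (insert x F) (insert y S)"
      using p by (intro exI)
    ultimately show ?thesis by (intro bexI[of _ y]) simp_all
  next
    case False
    then obtain f2 z2 y where f2: "inj_on f2 V" "z2 \<notin> f2 ` V" "full f2 z2 \<subseteq> insert y (insert x F)"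
      and y: "y \<notin> insert x F \<union> S"
      unfolding no_threat_def by (simp only: not_all not_imp) (elim exE conjE)
    have "y \<notin> S" using y by simp
    then have race': "core_race (insert x F) (insert y S)"
      using core_race_step[OF race fin(1,4) x(2) _ f2] by simp
    \<comment> \<open>\<open>no_threat\<close> ranges over arbitrary sets \<open>y\<close>;
      membership in the copy makes \<open>y\<close> an edge of the board.\<close>
    have "y \<in> full f2 z2"
    proof (rule ccontr)
      assume "y \<notin> full f2 z2"
      then have "full f2 z2 \<subseteq> insert x F" using f2(3) by (meson subset_insert)
      then have "contains_copy (insert x F) target"
        unfolding contains_target_iff using f2(1,2) by (intro exI conjI)
      then show False using \<open>\<not> contains_copy (insert x F) target\<close> by simp
    qed
    then have "y \<in> board_edges k" using full_board[OF f2(1,2)] by (rule subsetD[rotated])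
    then show ?thesis using race' y f(2) by (intro bexI[of _ y]) auto
  qed
qed

lemma drawing_invariant_drawn: "drawing_invariant k target drawn"
  unfolding drawing_invariant_def
proof (intro allI impI)
  fix F S x
  assume d: "drawn F S" and nc: "\<not> contains_copy S target"
    and x: "x \<in> board_edges k" "x \<notin> F \<union> S"
  have fin: "finite F" "finite S" "F \<union> S \<subseteq> board_edges k" "F \<inter> S = {}"
    using d unfolding drawn_def by simp_all
  have xF: "x \<notin> F" using x(2) by simp
  let ?next = "\<lambda>y. contains_copy (insert y S) target \<or> opening_path (insert x F) (insert y S) \<or>
      opening_closers (insert x F) (insert y S) \<or> opening_last (insert x F) (insert y S) \<or>
      (\<exists>f. inj_on f V \<and> core f \<subseteq> insert y S) \<and> core_race (insert x F) (insert y S) \<or>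
      (\<exists>f A B F0 Z z. perpetual f A B F0 Z z (insert x F) (insert y S))"
  have "\<not> contains_copy (insert x F) target \<and> (\<exists>y\<in>board_edges k. y \<notin> insert x (F \<union> S) \<and> ?next y)"
  proof -
    consider (start) "opening_path F S \<or> opening_closers F S \<or> opening_last F S"
      | (race) f where "inj_on f V" "core f \<subseteq> S" "core_race F S"
      | (perpetual) f A B F0 Z z where "perpetual f A B F0 Z z F S"
      using d nc unfolding drawn_def by metis
    then show ?thesis
    proof cases
      case start
      have "\<exists>y\<in>board_edges k. y \<notin> insert x (F \<union> S) \<and> ?next y"
        using start
      proof (elim disjE)
        assume o: "opening_path F S"
        obtain y where "y \<in> board_edges k" "y \<notin> insert x (F \<union> S)"
          "opening_path (insert x F) (insert y S) \<or> opening_closers (insert x F) (insert y S)"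
          using opening_path_step[OF o xF x(1) fin(1-3)] by (elim bexE conjE)
        then show ?thesis by (intro bexI[of _ y] conjI) (elim disjE; simp)+
      next
        assume o: "opening_closers F S"
        obtain y where "y \<in> board_edges k" "y \<notin> insert x (F \<union> S)"
          "opening_last (insert x F) (insert y S)"
          using opening_closers_step[OF o xF fin(1)] by (elim bexE conjE)
        then show ?thesis by (intro bexI[of _ y]) simp_all
      next
        assume o: "opening_last F S"
        obtain y f where "y \<in> board_edges k" "y \<notin> insert x (F \<union> S)"
          "inj_on f V" "core f \<subseteq> insert y S" "core_race (insert x F) (insert y S)"
          using opening_last_step[OF o xF fin(1)] by (elim bexE exE conjE)
        then show ?thesis by (intro bexI[of _ y] conjI disjI2 disjI1 exI[of _ f])
      qed
      then show ?thesis
        using not_contains_target_small[OF fin(1) card_opening_less[OF start]] by simp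
    next
      case race
      obtain y where y: "y \<in> board_edges k" "y \<notin> insert x (F \<union> S)"
        "core f \<subseteq> insert y S \<and> core_race (insert x F) (insert y S) \<or>
         (\<exists>f A B F0 Z z. perpetual f A B F0 Z z (insert x F) (insert y S))"
        using core_race_move[OF race fin x] by (elim bexE conjE)
      have "?next y"
        using y(3)
      proof
        assume "core f \<subseteq> insert y S \<and> core_race (insert x F) (insert y S)"
        then have "(\<exists>f. inj_on f V \<and> core f \<subseteq> insert y S) \<and> core_race (insert x F) (insert y S)"
          using race(1) by (intro conjI exI[of _ f]) simp_all
        then show ?thesis by simp
      qed simp
      then show ?thesis using core_race_move[OF race fin x] y(1,2) by (intro conjI bexI[of _ y]) simp_all
    next
      case perpetual
      have "\<not> contains_copy (insert x F) target"
        unfolding contains_target_iff using perpetual_no_copy[OF perpetual x(2)] by metis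
      moreover obtain y where y: "y \<in> board_edges k" "y \<notin> insert x (F \<union> S)"
        "contains_copy (insert y S) target \<or>
         (\<exists>z'. perpetual f A B F0 (insert z Z) z' (insert x F) (insert y S))"
        using perpetual_step[OF perpetual x(1) fin(1-3)] by (elim bexE conjE)
      have "?next y"
        using y(3)
      proof
        assume "\<exists>z'. perpetual f A B F0 (insert z Z) z' (insert x F) (insert y S)"
        then have "\<exists>f A B F0 Z z. perpetual f A B F0 Z z (insert x F) (insert y S)"
          by (elim exE) (intro exI)
        then show ?thesis by simp
      qed simp
      ultimately show ?thesis using y(1,2) by (intro conjI bexI[of _ y]) simp_all
    qed
  qed
  then obtain y where nc': "\<not> contains_copy (insert x F) target"
    and y: "y \<in> board_edges k" "y \<notin> insert x (F \<union> S)" "?next y"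
    by (elim conjE bexE)
  have "insert x F \<inter> insert y S = {}" using fin(4) x(2) y(2) by auto
  then have "drawn (insert x F) (insert y S)"
    unfolding drawn_def using fin x(1) y(1,3) by simp
  then show "\<not> contains_copy (insert x F) target \<and>
      (\<exists>y\<in>board_edges k. y \<notin> insert x (F \<union> S) \<and> drawn (insert x F) (insert y S))"
    using nc' y(1,2) by (intro conjI bexI[of _ y]) simp_all
qed

lemma strong_game_draw_target: "strong_game_draw k target"
proof -
  \<comment> \<open>While \<open>F\<close> is empty the path has length \<open>0\<close> and
    \<open>S\<close> is arbitrary, which admits the idle first edge of a drawing player who
    starts.\<close>
  have path: "opening_path {} S" for S
    unfolding opening_path_def using v_fresh(1) by (intro exI[of _ 0]) simp
  have ne: "target \<noteq> {}" by (simp add: target_def)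
  obtain d where d: "d \<in> board_edges k" using ex_free_edge[OF k_pos, of "{}"] by auto
  have "drawn {} {}" "drawn {} {d}" unfolding drawn_def using path d by simp_all
  then show ?thesis
    unfolding strong_game_draw_def
    using not_FP_has_winning_strategy[OF k_pos ne drawing_invariant_drawn]
      not_SP_has_winning_strategy[OF k_pos ne drawing_invariant_drawn d] by simp
qed

lemma uniform_hypergraph_target: "uniform_hypergraph k target"
proof -
  have "card (insert \<zeta> X) = k" if "X \<subseteq> V" "card X = k - 1" for X
    using that spots(4) finite_V finite_subset[of X V] k_pos by (metis Suc_diff_1 card_insert_disjoint subsetD)
  then show ?thesis
    using card_edge finite_edge finite_C card_spot spots finite_spots
    by (auto simp: uniform_hypergraph_def target_def)
qed

end

section \<open>A rigid core with twelve vertices\<close>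

text \<open>Backtracking search: every injective map from all but \<open>b\<close> of the remaining indices to
  \<open>js\<close> that preserves \<open>M\<close> and extends \<open>as\<close> is the identity. It is applied with
  \<open>M\<close> the sizes of the pairwise intersections of edges, which are preserved by copies.\<close>

fun pinned :: "nat list \<Rightarrow> (nat \<Rightarrow> nat \<Rightarrow> nat) \<Rightarrow> nat list \<Rightarrow> (nat \<times> nat) list \<Rightarrow> nat \<Rightarrow> bool" where
  "pinned js M [] as b \<longleftrightarrow> list_all (\<lambda>(i, j). i = j) as"
| "pinned js M (i # is) as b \<longleftrightarrow>
     (case b of 0 \<Rightarrow> True | Suc b' \<Rightarrow> pinned js M is as b') \<and>
     list_all (\<lambda>j. if list_all (\<lambda>(i', j'). j' \<noteq> j \<and> M i i' = M j j') as
       then pinned js M is ((i, j) # as) b else True) js"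

text \<open>The search contains a branch that follows \<open>\<psi>\<close>: at an index of
  \<open>D\<close> the choice \<open>\<psi> i\<close> passes the test, and any other index costs one
  unit of the budget \<open>b\<close>, which bounds the number of such indices.\<close>

lemma pinnedD:
  assumes "pinned js M is as b"
    and "card (set is - D) \<le> b" "\<psi> ` D \<subseteq> set js" "inj_on \<psi> D"
    and "\<And>i i'. i \<in> D \<Longrightarrow> i' \<in> D \<Longrightarrow> i \<noteq> i' \<Longrightarrow> M (\<psi> i) (\<psi> i') = M i i'"
    and "distinct is" "\<forall>(i, j)\<in>set as. i \<in> D \<and> j = \<psi> i \<and> i \<notin> set is"
  shows "(\<forall>(i, j)\<in>set as. i = j) \<and> (\<forall>i\<in>set is \<inter> D. \<psi> i = i)"
  using assms
proof (induction js M "is" as b rule: pinned.induct)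
  case (1 js M as b)
  then show ?case by (auto simp: list_all_iff)
next
  case (2 js M i "is" as b)
  show ?case
  proof (cases "i \<in> D")
    case True
    have mem: "\<psi> i \<in> set js" using "2.prems"(3) True by blast
    have consistent: "list_all (\<lambda>(i', j'). j' \<noteq> \<psi> i \<and> M i i' = M (\<psi> i) j') as"
      unfolding list_all_iff
    proof safe
      fix i' assume "(i', \<psi> i) \<in> set as"
      then have "i' \<in> D" "\<psi> i = \<psi> i'" "i' \<noteq> i" using "2.prems"(7) by auto
      then show False using inj_onD[OF "2.prems"(4)] True by metis
    next
      fix i' j' assume "(i', j') \<in> set as"
      then have "i' \<in> D" "j' = \<psi> i'" "i' \<noteq> i" using "2.prems"(7) by auto
      then show "M i i' = M (\<psi> i) j'" using "2.prems"(5) True by metis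
    qed
    have pinned: "pinned js M is ((i, \<psi> i) # as) b"
      using "2.prems"(1) mem consistent by (auto simp: list_all_iff)
    have card: "card (set is - D) \<le> b" using "2.prems"(2) True by (simp add: insert_Diff_if)
    have distinct: "distinct is" using "2.prems"(6) by simp
    have assigned: "\<forall>(i', j')\<in>set ((i, \<psi> i) # as). i' \<in> D \<and> j' = \<psi> i' \<and> i' \<notin> set is"
      using "2.prems"(6,7) True by auto
    have "(\<forall>(i, j)\<in>set ((i, \<psi> i) # as). i = j) \<and> (\<forall>i\<in>set is \<inter> D. \<psi> i = i)"
      by (rule "2.IH"(2)[OF mem consistent pinned card "2.prems"(3,4,5) distinct assigned])
    then show ?thesis by auto
  next
    case False
    have "set (i # is) - D = insert i (set is - D)" using False by auto
    then have "card (set is - D) < b" using "2.prems"(2,6) by simp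
    then obtain b' where b: "b = Suc b'" by (cases b) auto
    have pinned: "pinned js M is as b'" using "2.prems"(1) by (simp add: b)
    have card: "card (set is - D) \<le> b'" using \<open>card (set is - D) < b\<close> by (simp add: b)
    have distinct: "distinct is" using "2.prems"(6) by simp
    have assigned: "\<forall>(i', j')\<in>set as. i' \<in> D \<and> j' = \<psi> i' \<and> i' \<notin> set is"
      using "2.prems"(7) by auto
    have "(\<forall>(i, j)\<in>set as. i = j) \<and> (\<forall>i\<in>set is \<inter> D. \<psi> i = i)"
      by (rule "2.IH"(1)[OF b pinned card "2.prems"(3,4,5) distinct assigned])
    then show ?thesis using False by auto
  qed
qed

text \<open>Found by a computer search. The first ten edges form the core; in the first eight of them
  \<open>0\<close> and \<open>1\<close> are twins, and so are \<open>2\<close> and \<open>3\<close>. The vertex of degree two is \<open>12\<close>.\<close>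

definition edge_list :: "nat list list" where
  "edge_list = [[0,1,2,3,4], [0,1,2,3,5], [0,1,4,5,6], [0,1,5,6,7], [0,1,5,7,8], [5,6,7,8,9],
     [2,3,7,9,10], [4,5,7,10,11], [0,4,8,9,11], [2,6,8,10,11], [0,3,9,11,12], [0,3,6,10,12]]"

definition edge :: "nat \<Rightarrow> nat set" where
  "edge i = set (edge_list ! i)"

definition meet :: "nat \<Rightarrow> nat \<Rightarrow> nat" where
  "meet i j = length (filter (\<lambda>u. u \<in> set (edge_list ! j)) (edge_list ! i))"

text \<open>The search is evaluated by rewriting with this table; the index 1 appears as
  \<open>Suc 0\<close>, its simplifier normal form.\<close>

lemma meet_simps:
  "meet 0 0 = 5" "meet 0 (Suc 0) = 4" "meet 0 2 = 3" "meet 0 3 = 2" "meet 0 4 = 2" "meet 0 5 = 0"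
  "meet 0 6 = 2" "meet 0 7 = 1" "meet 0 8 = 2" "meet 0 9 = 1" "meet 0 10 = 2" "meet 0 11 = 2"
  "meet (Suc 0) 0 = 4" "meet (Suc 0) (Suc 0) = 5" "meet (Suc 0) 2 = 3" "meet (Suc 0) 3 = 3" "meet (Suc 0) 4 = 3" "meet (Suc 0) 5 = 1"
  "meet (Suc 0) 6 = 2" "meet (Suc 0) 7 = 1" "meet (Suc 0) 8 = 1" "meet (Suc 0) 9 = 1" "meet (Suc 0) 10 = 2" "meet (Suc 0) 11 = 2"
  "meet 2 0 = 3" "meet 2 (Suc 0) = 3" "meet 2 2 = 5" "meet 2 3 = 4" "meet 2 4 = 3" "meet 2 5 = 2"
  "meet 2 6 = 0" "meet 2 7 = 2" "meet 2 8 = 2" "meet 2 9 = 1" "meet 2 10 = 1" "meet 2 11 = 2"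
  "meet 3 0 = 2" "meet 3 (Suc 0) = 3" "meet 3 2 = 4" "meet 3 3 = 5" "meet 3 4 = 4" "meet 3 5 = 3"
  "meet 3 6 = 1" "meet 3 7 = 2" "meet 3 8 = 1" "meet 3 9 = 1" "meet 3 10 = 1" "meet 3 11 = 2"
  "meet 4 0 = 2" "meet 4 (Suc 0) = 3" "meet 4 2 = 3" "meet 4 3 = 4" "meet 4 4 = 5" "meet 4 5 = 3"
  "meet 4 6 = 1" "meet 4 7 = 2" "meet 4 8 = 2" "meet 4 9 = 1" "meet 4 10 = 1" "meet 4 11 = 1"
  "meet 5 0 = 0" "meet 5 (Suc 0) = 1" "meet 5 2 = 2" "meet 5 3 = 3" "meet 5 4 = 3" "meet 5 5 = 5"
  "meet 5 6 = 2" "meet 5 7 = 2" "meet 5 8 = 2" "meet 5 9 = 2" "meet 5 10 = 1" "meet 5 11 = 1"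
  "meet 6 0 = 2" "meet 6 (Suc 0) = 2" "meet 6 2 = 0" "meet 6 3 = 1" "meet 6 4 = 1" "meet 6 5 = 2"
  "meet 6 6 = 5" "meet 6 7 = 2" "meet 6 8 = 1" "meet 6 9 = 2" "meet 6 10 = 2" "meet 6 11 = 2"
  "meet 7 0 = 1" "meet 7 (Suc 0) = 1" "meet 7 2 = 2" "meet 7 3 = 2" "meet 7 4 = 2" "meet 7 5 = 2"
  "meet 7 6 = 2" "meet 7 7 = 5" "meet 7 8 = 2" "meet 7 9 = 2" "meet 7 10 = 1" "meet 7 11 = 1"
  "meet 8 0 = 2" "meet 8 (Suc 0) = 1" "meet 8 2 = 2" "meet 8 3 = 1" "meet 8 4 = 2" "meet 8 5 = 2"
  "meet 8 6 = 1" "meet 8 7 = 2" "meet 8 8 = 5" "meet 8 9 = 2" "meet 8 10 = 3" "meet 8 11 = 1"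
  "meet 9 0 = 1" "meet 9 (Suc 0) = 1" "meet 9 2 = 1" "meet 9 3 = 1" "meet 9 4 = 1" "meet 9 5 = 2"
  "meet 9 6 = 2" "meet 9 7 = 2" "meet 9 8 = 2" "meet 9 9 = 5" "meet 9 10 = 1" "meet 9 11 = 2"
  "meet 10 0 = 2" "meet 10 (Suc 0) = 2" "meet 10 2 = 1" "meet 10 3 = 1" "meet 10 4 = 1" "meet 10 5 = 1"
  "meet 10 6 = 2" "meet 10 7 = 1" "meet 10 8 = 3" "meet 10 9 = 1" "meet 10 10 = 5" "meet 10 11 = 3"
  "meet 11 0 = 2" "meet 11 (Suc 0) = 2" "meet 11 2 = 2" "meet 11 3 = 2" "meet 11 4 = 1" "meet 11 5 = 1"
  "meet 11 6 = 2" "meet 11 7 = 1" "meet 11 8 = 1" "meet 11 9 = 2" "meet 11 10 = 3" "meet 11 11 = 5"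
  by (simp_all add: meet_def edge_list_def)

text \<open>The budgets match the locale: one lost edge in \<open>almost_rigid\<close>, two in
  \<open>rigid\<close>.\<close>

lemma pinned_core: "pinned [0..<10] meet [0..<10] [] 1"
proof -
  have "[0..<10] = [0, Suc 0, 2, 3, 4, 5, 6, 7, 8, 9]" by (simp add: upt_rec)
  then show ?thesis by (simp add: meet_simps)
qed

lemma pinned_target: "pinned [0..<12] meet [0..<12] [] (Suc 1)"
proof -
  have "[0..<12] = [0, Suc 0, 2, 3, 4, 5, 6, 7, 8, 9, 10, 11]" by (simp add: upt_rec)
  then show ?thesis by (simp add: meet_simps)
qed

section \<open>Cardinalities read off the list of edges\<close>

lemma length_edge_list: "length edge_list = 12" by (simp add: edge_list_def)

lemma edge_list_props:
  "list_all distinct edge_list" "list_all (\<lambda>l. length l = 5) edge_list"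
  "list_all (list_all (\<lambda>u. u < 13)) edge_list"
  "list_all (list_all (\<lambda>u. u < 12)) (take 10 edge_list)"
  by (simp_all add: edge_list_def)

lemma edge_subset: "i < 12 \<Longrightarrow> edge i \<subseteq> {..<13}" "i < 10 \<Longrightarrow> edge i \<subseteq> {..<12}"
proof -
  show "edge i \<subseteq> {..<13}" if "i < 12"
    using edge_list_props(3) that by (auto simp: edge_def list_all_length length_edge_list in_set_conv_nth)
  have "\<forall>u\<in>set (take 10 edge_list ! i). u < 12" if "i < 10"
    using edge_list_props(4) that by (simp add: list_all_length length_edge_list all_set_conv_all_nth)
  then show "edge i \<subseteq> {..<12}" if "i < 10" using that by (auto simp: edge_def)
qed

lemma card_edge_Int: "i < 12 \<Longrightarrow> card (edge i \<inter> edge j) = meet i j"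
proof -
  assume "i < 12"
  then have "distinct (edge_list ! i)"
    using edge_list_props(1) by (simp add: list_all_length length_edge_list)
  then have "card (set (filter (\<lambda>u. u \<in> set (edge_list ! j)) (edge_list ! i))) = meet i j"
    unfolding meet_def by (intro distinct_card distinct_filter)
  moreover have "set (filter (\<lambda>u. u \<in> set (edge_list ! j)) (edge_list ! i)) = edge i \<inter> edge j"
    by (auto simp: edge_def)
  ultimately show ?thesis by simp
qed

text \<open>Each set is represented by the sorted list of its elements, so that distinctness is
  decided on lists.\<close>

lemma inj_on_edge: "inj_on edge {..<12}"
proof -
  have "distinct (map (\<lambda>l. filter (\<lambda>u. u \<in> set l) [0..<13]) edge_list)"
    by (simp add: edge_list_def upt_rec)
  then have *: "inj_on (\<lambda>i. filter (\<lambda>u. u \<in> edge i) [0..<13]) {..<12}"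
    by (auto simp: inj_on_def edge_def distinct_conv_nth length_edge_list)
  show ?thesis by (rule inj_onI, rule inj_onD[OF *]) simp_all
qed

lemma card_edge_filter:
  assumes "n \<le> 12"
  shows "card {i. i < n \<and> P (edge i)} = length (filter (\<lambda>l. P (set l)) (take n edge_list))"
proof -
  have "{i. i < length (take n edge_list) \<and> P (set (take n edge_list ! i))} = {i. i < n \<and> P (edge i)}"
    using assms by (auto simp: edge_def length_edge_list)
  then show ?thesis by (simp add: length_filter_conv_card)
qed

section \<open>Matching the edges and vertices of overlapping copies\<close>

text \<open>Common edges define a partial matching \<open>\<psi>\<close> of indices. It preserves
  \<open>meet\<close> because injective maps preserve the sizes of intersections, so the search
  forces it to be the identity.\<close>

lemma edge_images_agree:
  fixes g g' :: "nat \<Rightarrow> nat"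
  assumes g: "inj_on g W" "inj_on g' W" and n: "n \<le> 12" "\<And>i. i < n \<Longrightarrow> edge i \<subseteq> W"
    and pinned: "pinned [0..<n] meet [0..<n] [] b"
    and large: "n \<le> b + card ((\<lambda>i. g ` edge i) ` {..<n} \<inter> (\<lambda>i. g' ` edge i) ` {..<n})"
  shows "\<exists>D\<subseteq>{..<n}. card ({..<n} - D) \<le> b \<and> (\<forall>i\<in>D. g ` edge i = g' ` edge i)"
proof -
  define D where "D = {i. i < n \<and> g ` edge i \<in> (\<lambda>i. g' ` edge i) ` {..<n}}"
  have D: "D \<subseteq> {..<n}" by (auto simp: D_def)
  have "(\<lambda>i. g ` edge i) ` {..<n} \<inter> (\<lambda>i. g' ` edge i) ` {..<n} = (\<lambda>i. g ` edge i) ` D"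
    by (auto simp: D_def)
  moreover have "finite D" using D finite_subset by blast
  ultimately have "n \<le> b + card D"
    using large card_image_le[of D "\<lambda>i. g ` edge i"] by simp
  then have card: "card ({..<n} - D) \<le> b" using D \<open>finite D\<close> by (simp add: card_Diff_subset)
  have "\<forall>i\<in>D. \<exists>j. j < n \<and> g ` edge i = g' ` edge j" by (auto simp: D_def)
  then obtain \<psi> where \<psi>: "\<And>i. i \<in> D \<Longrightarrow> \<psi> i < n \<and> g ` edge i = g' ` edge (\<psi> i)" by metis
  have "inj_on \<psi> D"
  proof (rule inj_onI)
    fix i j assume ij: "i \<in> D" "j \<in> D" "\<psi> i = \<psi> j"
    then have "g ` edge i = g ` edge j" using \<psi> by metis
    then have "edge i = edge j"
      using inj_on_image_eq_iff[OF g(1)] n(2) ij D by (metis lessThan_iff subsetD)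
    moreover have "i < 12" "j < 12" using ij D n(1) by auto
    ultimately show "i = j" using inj_onD[OF inj_on_edge] by simp
  qed
  moreover have "meet (\<psi> i) (\<psi> j) = meet i j" if "i \<in> D" "j \<in> D" for i j
  proof -
    have lt: "i < n" "j < n" "\<psi> i < n" "\<psi> j < n" using that D \<psi> by auto
    have "card (edge (\<psi> i) \<inter> edge (\<psi> j)) = card (g' ` (edge (\<psi> i) \<inter> edge (\<psi> j)))"
      using lt n(2) by (intro card_image[symmetric] inj_on_subset[OF g(2)]) blast
    also have "\<dots> = card (g ` (edge i \<inter> edge j))"
      using inj_on_image_Int[OF g(2) n(2)[OF lt(3)] n(2)[OF lt(4)]]
        inj_on_image_Int[OF g(1) n(2)[OF lt(1)] n(2)[OF lt(2)]] \<psi>[OF that(1)] \<psi>[OF that(2)] by simp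
    also have "\<dots> = card (edge i \<inter> edge j)"
      using lt n(2) by (intro card_image inj_on_subset[OF g(1)]) blast
    finally show ?thesis using card_edge_Int lt n(1) by simp
  qed
  moreover have "card (set [0..<n] - D) \<le> b" using card by (simp add: atLeast0LessThan)
  moreover have "\<psi> ` D \<subseteq> set [0..<n]" using \<psi> by auto
  ultimately have "\<forall>i\<in>set [0..<n] \<inter> D. \<psi> i = i"
    using pinnedD[OF pinned, of D \<psi>] by simp
  then have "\<forall>i\<in>D. g ` edge i = g' ` edge i" using \<psi> D by (metis IntI atLeast0LessThan set_upt subsetD)
  then show ?thesis using D card by blast
qed

text \<open>The degree of \<open>u\<close> exceeds the number of unmatched edges, so
  \<open>u\<close> lies in a matched one and its image is also some \<open>g' w\<close>. Then
  \<open>u\<close> and \<open>w\<close> lie in the same matched edges, and only unmatched ones can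
  separate them.\<close>

lemma vertex_images_agree:
  fixes g g' :: "nat \<Rightarrow> nat"
  assumes g: "inj_on g W" "inj_on g' W" and n: "\<And>i. i < n \<Longrightarrow> edge i \<subseteq> W"
    and D: "D \<subseteq> {..<n}" "card ({..<n} - D) \<le> b" "\<And>i. i \<in> D \<Longrightarrow> g ` edge i = g' ` edge i"
    and u: "u \<in> W" "b < card {i. i < n \<and> u \<in> edge i}"
  shows "\<exists>w\<in>W. g u = g' w \<and> {i. i < n \<and> (u \<in> edge i) \<noteq> (w \<in> edge i)} \<subseteq> {..<n} - D"
proof -
  have "\<not> {i. i < n \<and> u \<in> edge i} \<subseteq> {..<n} - D"
    using u(2) D(2) card_mono[of "{..<n} - D" "{i. i < n \<and> u \<in> edge i}"] by auto
  then obtain i where i: "i \<in> D" "u \<in> edge i" by auto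
  then have "g u \<in> g' ` edge i" using D(3) by blast
  then obtain w where w: "w \<in> edge i" "g u = g' w" by auto
  have wW: "w \<in> W" using w(1) i(1) n D(1) by blast
  have "u \<in> edge j \<longleftrightarrow> w \<in> edge j" if "j \<in> D" for j
  proof -
    have "edge j \<subseteq> W" using that D(1) n by blast
    then show ?thesis
      using inj_on_image_mem_iff[OF g(1) u(1)] inj_on_image_mem_iff[OF g(2) wW] D(3)[OF that] w(2)
      by metis
  qed
  then show ?thesis using w(2) wW by blast
qed

section \<open>The core, its spots and the finite checks\<close>

definition path_edges :: "nat set list" where
  "path_edges = [{0,1,2,3,4}, {0,1,2,3,5}, {0,1,4,5,6}, {0,1,5,6,7}, {0,1,5,7,8}, {5,6,7,8,9},
     {2,3,7,9,10}, {4,5,7,10,11}]"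

definition core_edges :: "nat set set" where
  "core_edges = insert {0,4,8,9,11} (insert {2,6,8,10,11} (set path_edges))"

abbreviation spot_R :: "nat set" where "spot_R \<equiv> {0,3,9,11}"
abbreviation spot_G :: "nat set" where "spot_G \<equiv> {0,3,6,10}"

lemma core_edges_eq: "core_edges = edge ` {..<10}"
proof -
  have "core_edges = set (map set (take 10 edge_list))"
    by (simp add: core_edges_def path_edges_def edge_list_def insert_commute)
  also have "\<dots> = edge ` {..<10}"
    using nth_image[of 10 edge_list]
    by (simp add: edge_def[abs_def] length_edge_list image_image[symmetric] lessThan_atLeast0)
  finally show ?thesis .
qed

lemma spot_edges: "edge 10 = insert 12 spot_R" "edge 11 = insert 12 spot_G"
  by (auto simp: edge_def edge_list_def)

lemma Union_core_edges: "\<Union>core_edges = {..<12}"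
proof
  show "\<Union>core_edges \<subseteq> {..<12}" unfolding core_edges_eq using edge_subset(2) by blast
  have "{..<12} = {0,1,2,3,4,5,6,7,8,9,10,11::nat}" by (auto simp: less_Suc_eq numeral_eq_Suc)
  then show "{..<12} \<subseteq> \<Union>core_edges" by (simp add: core_edges_def path_edges_def)
qed

lemma core_copy_eq: "core_copy core_edges f = (\<lambda>i. f ` edge i) ` {..<10}"
  by (simp add: core_copy_def core_edges_eq image_image)

lemma full_copy_eq:
  "full_copy core_edges spot_R spot_G f z = (\<lambda>i. (f(12 := z)) ` edge i) ` {..<12}"
proof -
  let ?g = "f(12 := z)"
  have "?g ` edge i = f ` edge i" if "i < 10" for i
    using edge_subset(2)[OF that] by (intro image_cong) auto
  then have "(\<lambda>i. ?g ` edge i) ` {..<10} = core_copy core_edges f"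
    unfolding core_copy_eq by (rule image_cong[OF refl]) (simp del: fun_upd_apply)
  moreover have "{..<12} = insert 10 (insert 11 {..<10::nat})" by auto
  moreover have "?g ` edge 10 = insert z (f ` spot_R)" "?g ` edge 11 = insert z (f ` spot_G)"
    unfolding spot_edges by (simp_all add: insert_commute)
  ultimately show ?thesis by (simp add: full_copy_def)
qed

text \<open>Three separating edges survive the loss of two. \<open>w\<close> also ranges over
  \<open>12\<close>, so that a core vertex is not confused with the apex.\<close>

lemma separated_target:
  "list_all (\<lambda>u. list_all (\<lambda>w. u = w \<or>
     2 < length (filter (\<lambda>l. (u \<in> set l) \<noteq> (w \<in> set l)) edge_list)) [0..<13]) [0..<12]"
  unfolding edge_list_def by code_simp

text \<open>After the loss of one edge only twins can be confused: each pair is separated by one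
  closing edge alone.\<close>

lemma separated_core:
  "list_all (\<lambda>u. list_all (\<lambda>w. u = w \<or>
     1 < length (filter (\<lambda>l. (u \<in> set l) \<noteq> (w \<in> set l)) (take 10 edge_list)) \<or>
     {u, w} = {0, 1} \<or> {u, w} = {2, 3}) [0..<12]) [0..<12]"
  unfolding edge_list_def by code_simp

lemma core_degrees:
  "list_all (\<lambda>u. 2 < length (filter (\<lambda>l. u \<in> set l) (take 10 edge_list)) \<and>
     3 < length (filter (\<lambda>l. u \<in> set l) (take 10 edge_list))
       + (if u \<in> set [0,3,9,11] then 1 else 0) + (if u \<in> set [0,3,6,10] then 1 else 0)) [0..<12]"
  unfolding edge_list_def by code_simp

text \<open>The excluded value 3 is \<open>Suc (card (spot_R \<inter> spot_G))\<close>, as the spots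
  share \<open>0\<close> and \<open>3\<close>.\<close>

lemma core_degree3_meets:
  "list_all (\<lambda>u. length (filter (\<lambda>l. u \<in> set l) (take 10 edge_list)) \<noteq> 3 \<or>
     list_all (\<lambda>l. list_all (\<lambda>l'. u \<notin> set l \<or> u \<notin> set l' \<or> l = l' \<or>
       length (filter (\<lambda>w. w \<in> set l') l) \<noteq> 3) (take 10 edge_list)) (take 10 edge_list)) [0..<12]"
  unfolding edge_list_def by code_simp

lemma card_core_edges_filter:
  "card {e \<in> core_edges. P e} = length (filter (\<lambda>l. P (set l)) (take 10 edge_list))"
proof -
  have "{e \<in> core_edges. P e} = edge ` {i. i < 10 \<and> P (edge i)}" by (auto simp: core_edges_eq)
  moreover have "inj_on edge {i. i < 10 \<and> P (edge i)}" using inj_on_edge by (rule inj_on_subset) auto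
  ultimately have "card {e \<in> core_edges. P e} = card {i. i < 10 \<and> P (edge i)}"
    by (simp add: card_image)
  then show ?thesis using card_edge_filter[of 10 P] by simp
qed

lemma core_edges_memE:
  assumes "e \<in> core_edges"
  obtains l where "l \<in> set (take 10 edge_list)" "e = set l" "distinct l" "length l = 5"
proof -
  obtain i where "i < 10" "e = edge i" using assms by (auto simp: core_edges_eq)
  moreover have "edge_list ! i \<in> set (take 10 edge_list)" if "i < 10"
    using that by (auto simp: in_set_conv_nth length_edge_list intro!: exI[of _ i])
  ultimately show ?thesis
    using that[of "edge_list ! i"] edge_list_props(1,2)
    by (simp add: edge_def list_all_length length_edge_list)
qed

section \<open>Rigidity of the concrete core\<close>

text \<open>With \<open>12\<close> sent to the apex, ten common edges out of twelve leave at most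
  two unmatched. Every core vertex has degree at least 3 and is separated from any other vertex by
  at least 3 edges, so it is identified.\<close>

lemma rigid_target:
  assumes f: "inj_on f (\<Union>core_edges)" "inj_on f' (\<Union>core_edges)"
    and z: "z \<notin> f ` \<Union>core_edges" "z' \<notin> f' ` \<Union>core_edges"
    and large: "card core_edges \<le>
      card (full_copy core_edges spot_R spot_G f z \<inter> full_copy core_edges spot_R spot_G f' z')"
    and u: "u \<in> \<Union>core_edges"
  shows "f u = f' u"
proof -
  let ?g = "f(12 := z)" and ?g' = "f'(12 := z')"
  have "{..<13} = insert 12 {..<12::nat}" by auto
  then have g: "inj_on ?g {..<13}" "inj_on ?g' {..<13}"
    using f z unfolding Union_core_edges by (auto simp: inj_on_def)
  have "card core_edges = 10"
    using card_core_edges_filter[of "\<lambda>_. True"] by (simp add: length_edge_list)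
  then have "12 \<le> Suc 1 + card ((\<lambda>i. ?g ` edge i) ` {..<12} \<inter> (\<lambda>i. ?g' ` edge i) ` {..<12})"
    using large unfolding full_copy_eq by simp
  then obtain D where D: "D \<subseteq> {..<12}" "card ({..<12} - D) \<le> Suc 1"
    "\<forall>i\<in>D. ?g ` edge i = ?g' ` edge i"
    using edge_images_agree[OF g order_refl edge_subset(1) pinned_target] by blast
  have u12: "u < 12" using u unfolding Union_core_edges by simp
  have "2 < length (filter (\<lambda>l. u \<in> set l) (take 10 edge_list))"
    using core_degrees u12 by (simp add: list_all_iff)
  also have "\<dots> \<le> length (filter (\<lambda>l. u \<in> set l) (take 10 edge_list @ drop 10 edge_list))"
    unfolding filter_append by simp
  finally have deg: "Suc 1 < card {i. i < 12 \<and> u \<in> edge i}"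
    using card_edge_filter[of 12 "\<lambda>e. u \<in> e"] by (simp add: length_edge_list)
  obtain w where w: "w \<in> {..<13}" "?g u = ?g' w"
    "{i. i < 12 \<and> (u \<in> edge i) \<noteq> (w \<in> edge i)} \<subseteq> {..<12} - D"
    using vertex_images_agree[OF g edge_subset(1) D(1,2) _ _ deg] D(3) u12 by auto
  have "card {i. i < 12 \<and> (u \<in> edge i) \<noteq> (w \<in> edge i)} \<le> 2"
    using card_mono[OF _ w(3)] D(2) by simp
  then have "length (filter (\<lambda>l. (u \<in> set l) \<noteq> (w \<in> set l)) edge_list) \<le> 2"
    using card_edge_filter[of 12 "\<lambda>e. (u \<in> e) \<noteq> (w \<in> e)"] by (simp add: length_edge_list)
  then have "u = w"
    using separated_target[unfolded list_all_iff, rule_format, of u w] u12 w(1) by simp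
  then show ?thesis using w(2) u12 by simp
qed

text \<open>Vertex \<open>0\<close> can move to its twin only if edge 8 is unmatched, and
  \<open>3\<close> only if edge 9 is; at most one edge is unmatched, so at most one of them moves.
  One swap replaces one common vertex of the spots, so corresponding spots meet in 3 vertices and
  crossed ones in 1, never in 2.\<close>

lemma almost_rigid_core:
  assumes f: "inj_on f (\<Union>core_edges)" "inj_on f' (\<Union>core_edges)"
    and large: "card core_edges \<le> Suc (card (core_copy core_edges f \<inter> core_copy core_edges f'))"
  shows "f ` spot_R = f' ` spot_R \<and> f ` spot_G = f' ` spot_G \<or>
    card (spot_R \<inter> spot_G) \<notin> {card (f ` spot_R \<inter> f' ` spot_R), card (f ` spot_R \<inter> f' ` spot_G),
      card (f ` spot_G \<inter> f' ` spot_R), card (f ` spot_G \<inter> f' ` spot_G)}"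
proof -
  have inj: "inj_on f {..<12}" "inj_on f' {..<12}" using f unfolding Union_core_edges .
  have "card core_edges = 10"
    using card_core_edges_filter[of "\<lambda>_. True"] by (simp add: length_edge_list)
  then have "10 \<le> 1 + card ((\<lambda>i. f ` edge i) ` {..<10} \<inter> (\<lambda>i. f' ` edge i) ` {..<10})"
    using large unfolding core_copy_eq by simp
  then obtain D where D: "D \<subseteq> {..<10}" "card ({..<10} - D) \<le> 1" "\<forall>i\<in>D. f ` edge i = f' ` edge i"
    using edge_images_agree[OF inj _ edge_subset(2) pinned_core] by auto
  have moved: "\<exists>w<12. f u = f' w \<and> {i. i < 10 \<and> (u \<in> edge i) \<noteq> (w \<in> edge i)} \<subseteq> {..<10} - D \<and>
      (u = w \<or> {u, w} = {0, 1} \<or> {u, w} = {2, 3})" if u: "u < 12" for u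
  proof -
    have "2 < length (filter (\<lambda>l. u \<in> set l) (take 10 edge_list))"
      using core_degrees u by (simp add: list_all_iff)
    then have deg: "1 < card {i. i < 10 \<and> u \<in> edge i}"
      using card_edge_filter[of 10 "\<lambda>e. u \<in> e"] by simp
    obtain w where w: "w < 12" "f u = f' w"
      "{i. i < 10 \<and> (u \<in> edge i) \<noteq> (w \<in> edge i)} \<subseteq> {..<10} - D"
      using vertex_images_agree[OF inj edge_subset(2) D(1,2) _ _ deg] D(3) u by auto
    have "card {i. i < 10 \<and> (u \<in> edge i) \<noteq> (w \<in> edge i)} \<le> 1"
      using card_mono[OF _ w(3)] D(2) by simp
    then have "length (filter (\<lambda>l. (u \<in> set l) \<noteq> (w \<in> set l)) (take 10 edge_list)) \<le> 1"
      using card_edge_filter[of 10 "\<lambda>e. (u \<in> e) \<noteq> (w \<in> e)"] by simp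
    then have "u = w \<or> {u, w} = {0, 1} \<or> {u, w} = {2, 3}"
      using separated_core[unfolded list_all_iff, rule_format, of u w] u w(1) by simp
    then show ?thesis using w by blast
  qed
  have fixed: "f u = f' u" if "u < 12" "u \<notin> {0, 1, 2, 3}" for u
    using moved[OF that(1)] that(2) by (auto simp: doubleton_eq_iff)
  have at0: "f 0 = f' 0 \<or> f 0 = f' 1 \<and> 8 \<notin> D"
  proof -
    obtain w where w: "f 0 = f' w" "{i. i < 10 \<and> (0 \<in> edge i) \<noteq> (w \<in> edge i)} \<subseteq> {..<10} - D"
      "w = 0 \<or> w = 1"
      using moved[of 0] by (auto simp: doubleton_eq_iff)
    have "8 \<notin> D" if "w = 1"
    proof -
      have "8 \<in> {i. i < 10 \<and> (0 \<in> edge i) \<noteq> (w \<in> edge i)}"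
        by (simp add: that edge_def edge_list_def)
      then show ?thesis using w(2) by blast
    qed
    then show ?thesis using w by auto
  qed
  have at3: "f 3 = f' 3 \<or> f 3 = f' 2 \<and> 9 \<notin> D"
  proof -
    obtain w where w: "f 3 = f' w" "{i. i < 10 \<and> (3 \<in> edge i) \<noteq> (w \<in> edge i)} \<subseteq> {..<10} - D"
      "w = 3 \<or> w = 2"
      using moved[of 3] by (auto simp: doubleton_eq_iff)
    have "9 \<notin> D" if "w = 2"
    proof -
      have "9 \<in> {i. i < 10 \<and> (3 \<in> edge i) \<noteq> (w \<in> edge i)}"
        by (simp add: that edge_def edge_list_def)
      then show ?thesis using w(2) by blast
    qed
    then show ?thesis using w by auto
  qed
  have not_both: "8 \<in> D \<or> 9 \<in> D"
  proof (rule ccontr)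
    assume "\<not> (8 \<in> D \<or> 9 \<in> D)"
    then have "card {8, 9::nat} \<le> card ({..<10} - D)" by (intro card_mono) auto
    then show False using D(2) by simp
  qed
  have meet: "card (f' ` X \<inter> f' ` Y) = card (X \<inter> Y)" if "X \<subseteq> {..<12}" "Y \<subseteq> {..<12}" for X Y
  proof -
    have "f' ` X \<inter> f' ` Y = f' ` (X \<inter> Y)" using inj_on_image_Int[OF inj(2) that] by simp
    then show ?thesis using that by (simp add: card_image inj_on_subset[OF inj(2)] le_infI1)
  qed
  have common: "card (spot_R \<inter> spot_G) = 2" by simp
  consider "f 0 = f' 0" "f 3 = f' 3" | "f 0 = f' 1" "f 3 = f' 3" | "f 0 = f' 0" "f 3 = f' 2"
    using at0 at3 not_both by blast
  then show ?thesis
  proof cases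
    case 1
    then show ?thesis using fixed by simp
  next
    case 2
    then have eqs: "f ` spot_R = f' ` {1,3,9,11}" "f ` spot_G = f' ` {1,3,6,10}" using fixed by simp_all
    have "card (f ` spot_R \<inter> f' ` spot_R) = 3" "card (f ` spot_R \<inter> f' ` spot_G) = 1"
      "card (f ` spot_G \<inter> f' ` spot_R) = 1" "card (f ` spot_G \<inter> f' ` spot_G) = 3"
      unfolding eqs by (subst meet; simp)+
    then show ?thesis using common by simp
  next
    case 3
    then have eqs: "f ` spot_R = f' ` {0,2,9,11}" "f ` spot_G = f' ` {0,2,6,10}" using fixed by simp_all
    have "card (f ` spot_R \<inter> f' ` spot_R) = 3" "card (f ` spot_R \<inter> f' ` spot_G) = 1"
      "card (f ` spot_G \<inter> f' ` spot_R) = 1" "card (f ` spot_G \<inter> f' ` spot_G) = 3"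
      unfolding eqs by (subst meet; simp)+
    then show ?thesis using common by simp
  qed
qed

lemma closing_edges_neq: "{0,4,8,9,11} \<noteq> {1,4,8,9,11::nat}" "{2,6,8,10,11} \<noteq> {3,6,8,10,11::nat}"
proof -
  have "0 \<notin> {1,4,8,9,11::nat}" "2 \<notin> {3,6,8,10,11::nat}" by simp_all
  then show "{0,4,8,9,11} \<noteq> {1,4,8,9,11::nat}" "{2,6,8,10,11} \<noteq> {3,6,8,10,11::nat}"
    by (metis insertI1)+
qed

lemma rigid_core_edges:
  "rigid_core 5 core_edges spot_R spot_G 12 path_edges
     {0,4,8,9,11} {1,4,8,9,11} {2,6,8,10,11} {3,6,8,10,11} 11"
proof
  show "card e = 5" if "e \<in> core_edges" for e
    using that by (elim core_edges_memE) (simp add: distinct_card)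
  show "spot_R \<subseteq> \<Union>core_edges" "spot_G \<subseteq> \<Union>core_edges" "12 \<notin> \<Union>core_edges"
    unfolding Union_core_edges by simp_all
  have "9 \<in> spot_R" "9 \<notin> spot_G" by simp_all
  then show "spot_R \<noteq> spot_G" by metis
  show "4 \<le> card {e \<in> core_edges. u \<in> e} + of_bool (u \<in> spot_R) + of_bool (u \<in> spot_G)"
    and "3 \<le> card {e \<in> core_edges. u \<in> e}" if "u \<in> \<Union>core_edges" for u
  proof -
    have "u \<in> set [0..<12]" using that unfolding Union_core_edges by simp
    note * = core_degrees[unfolded list_all_iff, rule_format, OF this]
    show "3 \<le> card {e \<in> core_edges. u \<in> e}" using * by (simp add: card_core_edges_filter)
    show "4 \<le> card {e \<in> core_edges. u \<in> e} + of_bool (u \<in> spot_R) + of_bool (u \<in> spot_G)"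
      using conjunct2[OF *] unfolding card_core_edges_filter of_bool_def by simp
  qed
  show "card (e \<inter> e') \<noteq> Suc (card (spot_R \<inter> spot_G))"
    if u: "card {e \<in> core_edges. u \<in> e} = 3" "e \<in> core_edges" "e' \<in> core_edges" "u \<in> e" "u \<in> e'"
      and neq: "e \<noteq> e'" for u e e'
  proof -
    obtain l where l: "l \<in> set (take 10 edge_list)" "e = set l" "distinct l"
      using u(2) by (elim core_edges_memE)
    obtain l' where l': "l' \<in> set (take 10 edge_list)" "e' = set l'"
      using u(3) by (elim core_edges_memE)
    have "u \<in> \<Union>core_edges" using u(2,4) by blast
    then have "u \<in> set [0..<12]" unfolding Union_core_edges by simp
    then have "length (filter (\<lambda>w. w \<in> set l') l) \<noteq> 3"
      using core_degree3_meets u(1,4,5) neq l l'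
      unfolding list_all_iff card_core_edges_filter by blast
    moreover have "card (e \<inter> e') = length (filter (\<lambda>w. w \<in> set l') l)"
      using l l' distinct_card[of "filter (\<lambda>w. w \<in> set l') l"] by (simp add: Int_def)
    moreover have "spot_R \<inter> spot_G = {0, 3}" by auto
    ultimately show ?thesis by simp
  qed
  show "core_edges = insert {0,4,8,9,11} (insert {2,6,8,10,11} (set path_edges))"
    by (rule core_edges_def)
  show "card core_edges = length path_edges + 2"
    using card_core_edges_filter[of "\<lambda>_. True"] by (simp add: length_edge_list path_edges_def)
  show "\<not> path_edges ! j \<subseteq> \<Union>(set (take j path_edges))" if "j < length path_edges" for j
  proof -
    have "j = 0 \<or> j = 1 \<or> j = 2 \<or> j = 3 \<or> j = 4 \<or> j = 5 \<or> j = 6 \<or> j = 7"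
      using that by (simp add: path_edges_def) arith
    then show ?thesis by (elim disjE) (simp_all add: path_edges_def)
  qed
  show "path_edges \<noteq> []" "11 \<in> last path_edges" "11 \<notin> \<Union>(set (butlast path_edges))"
    by (simp_all add: path_edges_def)
  show "{0,4,8,9,11} \<noteq> {1,4,8,9,11::nat}" "{2,6,8,10,11} \<noteq> {3,6,8,10,11::nat}"
    by (rule closing_edges_neq)+
  have "9 \<in> {0,4,8,9,11::nat}" "9 \<in> {1,4,8,9,11::nat}" "9 \<notin> {2,6,8,10,11::nat}" "9 \<notin> {3,6,8,10,11::nat}"
    by simp_all
  then show "{{0,4,8,9,11}, {1,4,8,9,11}} \<inter> {{2,6,8,10,11}, {3,6,8,10,11::nat}} = {}"
    by blast
  have "5 \<in> last path_edges" by (simp add: path_edges_def)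
  then show "last path_edges \<notin> {{0,4,8,9,11}, {1,4,8,9,11}, {2,6,8,10,11}, {3,6,8,10,11}}" by auto
  show "11 \<in> {0,4,8,9,11} \<inter> {1,4,8,9,11} \<inter> {2,6,8,10,11} \<inter> {3,6,8,10,11::nat}"
    "{0,4,8,9,11} \<union> {1,4,8,9,11} \<union> {2,6,8,10,11} \<union> {3,6,8,10,11} \<subseteq> \<Union>(set path_edges)"
    by (simp_all add: path_edges_def)
  show "\<exists>\<rho>. inj_on \<rho> (\<Union>core_edges) \<and> \<rho> ` \<Union>core_edges \<subseteq> \<Union>core_edges \<and>
      (\<forall>e\<in>set path_edges. \<rho> ` e = e) \<and> \<rho> ` {0,4,8,9,11} = a \<and> \<rho> ` {2,6,8,10,11} = b"
    if "a \<in> {{0,4,8,9,11}, {1,4,8,9,11}}" "b \<in> {{2,6,8,10,11}, {3,6,8,10,11}}" for a b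
  proof -
    \<comment> \<open>The swaps of twins act independently: \<open>0\<close> and \<open>1\<close>
      occur in neither closer of the second pair, \<open>2\<close> and \<open>3\<close> in neither
      of the first, so compositions reach all four combinations.\<close>
    define \<sigma> where "\<sigma> = (if a = {0,4,8,9,11} then id else transpose 0 (1::nat))"
    define \<tau> where "\<tau> = (if b = {2,6,8,10,11} then id else transpose 2 (3::nat))"
    have fix01: "\<sigma> ` e = e" if "0 \<in> e \<longleftrightarrow> 1 \<in> e" for e
      using that by (simp add: \<sigma>_def transpose_image_eq)
    have fix23: "\<tau> ` e = e" if "2 \<in> e \<longleftrightarrow> 3 \<in> e" for e
      using that by (simp add: \<tau>_def transpose_image_eq)
    have path: "\<sigma> ` e = e" "\<tau> ` e = e" if "e \<in> set path_edges" for e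
      using that by (auto intro!: fix01 fix23 simp: path_edges_def)
    have "\<sigma> ` {0,4,8,9,11} = a"
      using that(1) by (auto simp: \<sigma>_def transpose_def)
    moreover have "\<tau> ` {2,6,8,10,11} = b"
      using that(2) by (auto simp: \<tau>_def transpose_def)
    moreover have "\<tau> ` {0,4,8,9,11} = {0,4,8,9,11}" by (rule fix23) simp
    moreover have "\<sigma> ` b = b" using that(2) by (intro fix01) auto
    moreover have "\<sigma> ` {..<12} = {..<12}" "\<tau> ` {..<12} = {..<12}" by (simp_all add: fix01 fix23)
    moreover have "inj \<sigma>" "inj \<tau>" by (simp_all add: \<sigma>_def \<tau>_def)
    then have "inj_on (\<sigma> \<circ> \<tau>) {..<12}" by (meson inj_compose inj_on_subset subset_UNIV)
    ultimately show ?thesis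
      unfolding Union_core_edges
      by (intro exI[of _ "\<sigma> \<circ> \<tau>"] conjI ballI) (simp_all only: image_comp[symmetric] path order_refl)
  qed
qed (use rigid_target almost_rigid_core in simp_all)

theorem theorem1p1:
  shows "\<exists>H. uniform_hypergraph 5 H \<and> H \<noteq> {} \<and> strong_game_draw 5 H"
proof -
  interpret rigid_core 5 core_edges spot_R spot_G 12 path_edges
    "{0,4,8,9,11}" "{1,4,8,9,11}" "{2,6,8,10,11}" "{3,6,8,10,11}" 11
    by (rule rigid_core_edges)
  have "target \<noteq> {}" by (simp add: target_def)
  then show ?thesis using uniform_hypergraph_target strong_game_draw_target by blast
qed

end
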